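(* Let $G$ be a Polish group with identity $e$ and let $\mu$ be a Borel probability measure on $G$. For all $x \in G$ and all $n \geq 1$, there exists a possible exact coupling of $\mathrm{RW}(e,\mu)$ and $\mathrm{RW}(x,\mu)$ with a coupling time $T$ satisfying $\mathbf{P}(T = n) > 0$ if and only if $\mu^n \wedge \theta_x^{-1}\mu^n \neq 0$. In particular, the possible exact coupling set $G_p$ satisfies $$G_p = \{x \in G : \exists n \geq 1,\ \mu^n \wedge \theta_x^{-1}\mu^n \neq 0\}.$$
   Context: A Polish group is a topological group whose topology is separable and completely metrizable. For $x \in G$, $\mathrm{RW}(x,\mu)$ is the law on $G^{\mathbb{N}}$ of the right random walk $S^x = \{S^x_n\}_{n=0}^\infty$ with $S^x_n = x X_1 X_2 \cdots X_n$, where the $X_i$ are i.i.d. with distribution $\mu$. An exact coupling of $\mathrm{RW}(e,\mu)$ and $\mathrm{RW}(x,\mu)$ is a triple $(S,S^x,T)$ defined on one probability space $(\Omega,\mathcal{F},\mathbf{P})$ with $S \sim \mathrm{RW}(e,\mu)$, $S^x \sim \mathrm{RW}(x,\mu)$ and $T$ a random time (with values in $\{0,1,2,\dots\}\cup\{\infty\}$), called a coupling time, such that $S_n = S^x_n$ for all $n \geq T$. It is a possible exact coupling if $\mathbf{P}(T < \infty) > 0$. The possible exact coupling set $G_p$ is the set of all $x \in G$ such that there exists a possible exact coupling of $\mathrm{RW}(e,\mu)$ and $\mathrm{RW}(x,\mu)$. For a Borel measure $\nu$ on $G$, $\nu^n$ is the $n$-fold convolution of $\nu$ with itself. The shift $\theta_x\nu$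 is $\theta_x\nu(B) = \nu(x^{-1}B)$, so $\theta_x^{-1}\nu(B) = \nu(xB)$. $\nu_1 \wedge \nu_2$ is the largest measure that is $\leq \nu_1$ and $\leq \nu_2$, and $0$ denotes the zero measure. *)

theory Defs
  imports "HOL-Probability.Probability"
begin

text \<open>
  A Polish group is a type of sort \<open>{topological_group_add, polish_space}\<close>. As usual in the library
  the group operation is written additively, but it is \<^emph>\<open>not\<close> assumed to be commutative:
  \<open>x y\<close>, \<open>e\<close> and the inverse of \<open>x\<close> appear as \<open>x + y\<close>, \<open>0\<close> and \<open>- x\<close>.
  The complete metric of \<open>polish_space\<close> enters below only through its topology.
\<close>

text \<open>
  The increments are the coordinates on the product space \<open>Pi\<^sub>M UNIV (\<lambda>_. \<mu>)\<close>, with \<open>\<omega> i\<close> in the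
  role of the \<open>(i + 1)\<close>-st increment. \<open>sum_list\<close> multiplies from left to right.
\<close>

definition RW ::
  "'a::{topological_group_add, polish_space} \<Rightarrow> 'a measure \<Rightarrow> (nat \<Rightarrow> 'a) measure" where
  "RW x \<mu> = distr (\<Pi>\<^sub>M i\<in>UNIV. \<mu>) (\<Pi>\<^sub>M n\<in>UNIV. borel) (\<lambda>\<omega> n. x + sum_list (map \<omega> [0..<n]))"

definition exact_coupling ::
  "'a::{topological_group_add, polish_space} measure \<Rightarrow> 'a \<Rightarrow> 'w measure \<Rightarrow>
    ('w \<Rightarrow> nat \<Rightarrow> 'a) \<Rightarrow> ('w \<Rightarrow> nat \<Rightarrow> 'a) \<Rightarrow> ('w \<Rightarrow> enat) \<Rightarrow> bool" where
  "exact_coupling \<mu> x P S Sx T \<longleftrightarrow>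
    prob_space P \<and>
    S \<in> measurable P (\<Pi>\<^sub>M n\<in>UNIV. borel) \<and> distr P (\<Pi>\<^sub>M n\<in>UNIV. borel) S = RW 0 \<mu> \<and>
    Sx \<in> measurable P (\<Pi>\<^sub>M n\<in>UNIV. borel) \<and> distr P (\<Pi>\<^sub>M n\<in>UNIV. borel) Sx = RW x \<mu> \<and>
    T \<in> measurable P (count_space UNIV) \<and>
    (\<forall>\<omega>\<in>space P. \<forall>n. T \<omega> \<le> enat n \<longrightarrow> S \<omega> n = Sx \<omega> n)"

definition possible_exact_coupling ::
  "'a::{topological_group_add, polish_space} measure \<Rightarrow> 'a \<Rightarrow> 'w measure \<Rightarrow>
    ('w \<Rightarrow> nat \<Rightarrow> 'a) \<Rightarrow> ('w \<Rightarrow> nat \<Rightarrow> 'a) \<Rightarrow> ('w \<Rightarrow> enat) \<Rightarrow> bool" where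
  "possible_exact_coupling \<mu> x P S Sx T \<longleftrightarrow>
    exact_coupling \<mu> x P S Sx T \<and> measure P {\<omega> \<in> space P. T \<omega> < \<infinity>} > 0"

text \<open>
  HOL cannot quantify existentially over the type of the sample space, so ``there exists a
  coupling'' is expressed with sample points taken from the type below (with an arbitrary
  probability space on it). The lemma \<open>possible_exact_coupling_canonical\<close> shows that nothing is lost:
  a coupling on a sample space of any type yields one here, with the same law of the coupling time.
\<close>

type_synonym 'a coupling_point = "(nat \<Rightarrow> 'a) \<times> (nat \<Rightarrow> 'a) \<times> enat"

lemma possible_exact_coupling_canonical:
  fixes \<mu> :: "'a::{topological_group_add, polish_space} measure" and P :: "'w measure"
  assumes "possible_exact_coupling \<mu> x P S Sx T"
  obtains Q :: "'a coupling_point measure" and R Rx U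
  where "possible_exact_coupling \<mu> x Q R Rx U"
    and "\<And>A. measure Q {\<omega> \<in> space Q. U \<omega> \<in> A} = measure P {\<omega> \<in> space P. T \<omega> \<in> A}"
proof -
  define N :: "(nat \<Rightarrow> 'a) measure" where "N = (\<Pi>\<^sub>M n\<in>UNIV. borel)"
  define K :: "'a coupling_point measure" where
    "K = restrict_space (N \<Otimes>\<^sub>M N \<Otimes>\<^sub>M count_space UNIV)
      {(s, s', t). \<forall>n. t \<le> enat n \<longrightarrow> s n = s' n}"
  define f where "f = (\<lambda>\<omega>. (S \<omega>, Sx \<omega>, T \<omega>))"
  define Q where "Q = distr P K f"
  define R :: "'a coupling_point \<Rightarrow> nat \<Rightarrow> 'a" where "R = fst"
  define Rx :: "'a coupling_point \<Rightarrow> nat \<Rightarrow> 'a" where "Rx = (\<lambda>\<omega>. fst (snd \<omega>))"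
  define U :: "'a coupling_point \<Rightarrow> enat" where "U = (\<lambda>\<omega>. snd (snd \<omega>))"
  have "exact_coupling \<mu> x P S Sx T" and pos: "measure P {\<omega> \<in> space P. T \<omega> < \<infinity>} > 0"
    using assms by (auto simp: possible_exact_coupling_def)
  then have P: "prob_space P"
    and S: "S \<in> measurable P N" "distr P N S = RW 0 \<mu>"
    and Sx: "Sx \<in> measurable P N" "distr P N Sx = RW x \<mu>"
    and T: "T \<in> measurable P (count_space UNIV)"
    and eq: "\<forall>\<omega>\<in>space P. \<forall>n. T \<omega> \<le> enat n \<longrightarrow> S \<omega> n = Sx \<omega> n"
    by (auto simp: exact_coupling_def N_def)
  have f: "f \<in> measurable P K"
    unfolding K_def f_def using S(1) Sx(1) T eq
    by (intro measurable_restrict_space2) auto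
  have R: "R \<in> measurable K N" and Rx: "Rx \<in> measurable K N"
    and U: "U \<in> measurable K (count_space UNIV)"
    unfolding K_def R_def Rx_def U_def by (intro measurable_restrict_space1; measurable)+
  have "prob_space Q"
    unfolding Q_def using P f by (rule prob_space.prob_space_distr)
  moreover have "distr Q N R = RW 0 \<mu>" "distr Q N Rx = RW x \<mu>"
    unfolding Q_def distr_distr[OF R f] distr_distr[OF Rx f] S(2)[symmetric] Sx(2)[symmetric]
    by (simp_all add: f_def R_def Rx_def o_def)
  moreover have "\<forall>\<omega>\<in>space Q. \<forall>n. U \<omega> \<le> enat n \<longrightarrow> R \<omega> n = Rx \<omega> n"
    by (auto simp: Q_def K_def space_restrict_space R_def Rx_def U_def)
  ultimately have ex: "exact_coupling \<mu> x Q R Rx U"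
    using R Rx U by (auto simp: exact_coupling_def N_def Q_def)
  have law: "measure Q {\<omega> \<in> space Q. U \<omega> \<in> A} = measure P {\<omega> \<in> space P. T \<omega> \<in> A}" for A
  proof -
    have "{\<omega> \<in> space K. U \<omega> \<in> A} \<in> sets K"
      using U by measurable
    then have "measure Q {\<omega> \<in> space K. U \<omega> \<in> A} = measure P (f -` {\<omega> \<in> space K. U \<omega> \<in> A} \<inter> space P)"
      unfolding Q_def by (intro measure_distr f)
    also have "f -` {\<omega> \<in> space K. U \<omega> \<in> A} \<inter> space P = {\<omega> \<in> space P. T \<omega> \<in> A}"
      using measurable_space[OF f] by (auto simp: f_def U_def)
    finally show ?thesis by (simp add: Q_def)
  qed
  have "possible_exact_coupling \<mu> x Q R Rx U"
    using ex pos law[of "{..<\<infinity>}"] by (simp add: possible_exact_coupling_def)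
  then show thesis using law by (rule that)
qed

definition possible_exact_coupling_set ::
  "'a::{topological_group_add, polish_space} measure \<Rightarrow> 'a set" where
  "possible_exact_coupling_set \<mu> =
    {x. \<exists>(P :: 'a coupling_point measure) S Sx T. possible_exact_coupling \<mu> x P S Sx T}"

text \<open>The library's \<open>convolution\<close> is restricted to Euclidean spaces.\<close>

definition conv ::
  "'a::{topological_group_add, polish_space} measure \<Rightarrow> 'a measure \<Rightarrow> 'a measure" where
  "conv \<nu> \<nu>' = distr (\<nu> \<Otimes>\<^sub>M \<nu>') borel (\<lambda>(y, z). y + z)"

primrec conv_pow ::
  "'a::{topological_group_add, polish_space} measure \<Rightarrow> nat \<Rightarrow> 'a measure" where
  "conv_pow \<nu> 0 = return borel 0"
| "conv_pow \<nu> (Suc n) = conv \<nu> (conv_pow \<nu> n)"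

definition theta ::
  "'a::{topological_group_add, polish_space} \<Rightarrow> 'a measure \<Rightarrow> 'a measure" where
  "theta x \<nu> = distr \<nu> borel (\<lambda>y. x + y)"

lemma emeasure_theta:
  assumes "sets \<nu> = sets borel" "B \<in> sets borel"
  shows "emeasure (theta x \<nu>) B = emeasure \<nu> ((\<lambda>y. - x + y) ` B)"
proof -
  have "(\<lambda>y. x + y) \<in> measurable \<nu> borel"
    using assms(1) by (simp cong: measurable_cong_sets)
  moreover have "(\<lambda>y. x + y) -` B = (\<lambda>y. - x + y) ` B"
    by (auto simp: image_iff add.assoc[symmetric] intro!: bexI[of _ "x + _"])
  ultimately show ?thesis
    using assms sets_eq_imp_space_eq[OF assms(1)] by (simp add: theta_def emeasure_distr)
qed

text \<open>
  \<open>\<nu>\<^sub>1 \<and> \<nu>\<^sub>2\<close> is \<open>inf\<close> in the library's complete lattice of measures. That order also compares measures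
  on different \<open>\<sigma>\<close>-algebras; the next lemma confirms that for Borel measures \<open>inf\<close> is the largest
  Borel measure below both in the setwise order. The zero measure is \<open>null_measure borel\<close>.
\<close>

lemma inf_borel_measure:
  fixes \<nu>\<^sub>1 \<nu>\<^sub>2 :: "'a::topological_space measure"
  assumes "sets \<nu>\<^sub>1 = sets borel" "sets \<nu>\<^sub>2 = sets borel"
  shows "sets (inf \<nu>\<^sub>1 \<nu>\<^sub>2) = sets borel"
    and "emeasure (inf \<nu>\<^sub>1 \<nu>\<^sub>2) B \<le> emeasure \<nu>\<^sub>1 B" "emeasure (inf \<nu>\<^sub>1 \<nu>\<^sub>2) B \<le> emeasure \<nu>\<^sub>2 B"
    and "\<lbrakk>sets \<nu> = sets borel; \<forall>A\<in>sets borel. emeasure \<nu> A \<le> emeasure \<nu>\<^sub>1 A;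
      \<forall>A\<in>sets borel. emeasure \<nu> A \<le> emeasure \<nu>\<^sub>2 A; A \<in> sets borel\<rbrakk>
      \<Longrightarrow> emeasure \<nu> A \<le> emeasure (inf \<nu>\<^sub>1 \<nu>\<^sub>2) A"
proof -
  have "null_measure borel \<le> \<nu>\<^sub>1" "null_measure borel \<le> \<nu>\<^sub>2"
    using assms by (simp_all add: le_measure)
  then have "null_measure borel \<le> inf \<nu>\<^sub>1 \<nu>\<^sub>2" by simp
  moreover have le1: "inf \<nu>\<^sub>1 \<nu>\<^sub>2 \<le> \<nu>\<^sub>1" and le2: "inf \<nu>\<^sub>1 \<nu>\<^sub>2 \<le> \<nu>\<^sub>2" by simp_all
  ultimately show s: "sets (inf \<nu>\<^sub>1 \<nu>\<^sub>2) = sets borel"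
    using assms sets_eq_imp_space_eq[OF assms(1)]
    by (auto simp: le_measure_iff split: if_split_asm)
  show "emeasure (inf \<nu>\<^sub>1 \<nu>\<^sub>2) B \<le> emeasure \<nu>\<^sub>1 B"
    using le_measure[THEN iffD1, OF _ le1] s assms
    by (cases "B \<in> sets borel") (auto simp: emeasure_notin_sets)
  show "emeasure (inf \<nu>\<^sub>1 \<nu>\<^sub>2) B \<le> emeasure \<nu>\<^sub>2 B"
    using le_measure[THEN iffD1, OF _ le2] s assms
    by (cases "B \<in> sets borel") (auto simp: emeasure_notin_sets)
  assume n: "sets \<nu> = sets borel" "\<forall>A\<in>sets borel. emeasure \<nu> A \<le> emeasure \<nu>\<^sub>1 A"
    "\<forall>A\<in>sets borel. emeasure \<nu> A \<le> emeasure \<nu>\<^sub>2 A" "A \<in> sets borel"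
  have "\<nu> \<le> inf \<nu>\<^sub>1 \<nu>\<^sub>2" using n assms by (simp add: le_measure)
  then show "emeasure \<nu> A \<le> emeasure (inf \<nu>\<^sub>1 \<nu>\<^sub>2) A"
    using le_measure[of \<nu> "inf \<nu>\<^sub>1 \<nu>\<^sub>2"] n(1,4) s by blast
qed

end

theory Submission
  imports Defs
begin

text \<open>
  Write \<open>m\<close> for the law of \<open>X\<^sub>1 \<cdots> X\<^sub>n\<close>, so that the two walks are at time \<open>n\<close> distributed as \<open>m\<close> and as
  \<open>theta x m\<close>. Translation by \<open>- x\<close> turns the pair \<open>(m, theta x m)\<close> into \<open>(theta (- x) m, m)\<close>, so
  the condition of the theorem says that these two laws have a common nonzero part
  (\<open>overlap_iff\<close>).

  If a coupling has \<open>T \<le> n\<close> with positive probability, then the law of the common position at time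
  \<open>n\<close> on that event is nonzero and lies below both laws (\<open>overlap_if_coupling\<close>). Working with
  \<open>T \<le> n\<close> instead of \<open>T = n\<close> lets a coupling time \<open>0\<close> count as an overlap at time \<open>1\<close>, which
  is what the description of the possible exact coupling set by some \<open>n \<ge> 1\<close> requires.

  Conversely, let \<open>\<rho> \<noteq> 0\<close> lie below both \<open>m\<close> and \<open>theta x m\<close>. By the Markov property the path after
  time \<open>n\<close> is a walk started from the law at time \<open>n\<close> (\<open>distr_RW_shift\<close>), so the walk started from
  \<open>\<rho>\<close> is a nonzero common part of the laws of the two shifted paths. It remains to couple two random
  elements \<open>\<omega>\<close>, \<open>\<omega>'\<close> of a Polish space with prescribed laws so that prescribed functions of them
  (here: the shifted paths) agree with positive probability, given that the laws of these functions
  overlap (\<open>acceptance_coupling\<close>). Sample \<open>\<omega>\<close>, accept \<open>\<theta> \<omega>\<close> with the probability given by the density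
  of the common part, replace it by an independent sample of the residual law if it is rejected, and
  let \<open>z\<close> be the outcome: its law is the law of \<open>\<theta>' \<omega>'\<close>. Finally draw \<open>\<omega>'\<close> from its conditional law
  given \<open>\<theta>' \<omega>' = z\<close>. The coupling time is \<open>n\<close> if the two paths agree from time \<open>n\<close> on, and
  \<open>\<infinity>\<close> otherwise.

  The last sampling step needs a disintegration, and this is where completeness of the group
  enters. It takes the form of a measurable function \<open>\<Psi>\<close> of \<open>z\<close> and an independent uniform
  variable (\<open>noise_outsourcing\<close>). For extended-real variables \<open>\<Psi>\<close> is the quantile function of the
  conditional distribution function (\<open>conditional_quantile\<close>); the general case follows because a
  Polish space is a measurable retract of the real line (\<open>polish_real_code\<close>).
\<close>

section \<open>Uniform variables and bounded densities\<close>

definition unif :: "real measure" where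
  "unif = uniform_measure lborel {0..1}"

lemma sets_unif [measurable_cong, simp]: "sets unif = sets borel"
  and space_unif [simp]: "space unif = UNIV"
  by (simp_all add: unif_def)

lemma prob_space_unif: "prob_space unif"
  unfolding unif_def by (rule prob_space_uniform_measure) auto

lemma emeasure_unif_lessThan:
  assumes "0 \<le> p" "p \<le> 1"
  shows "emeasure unif {..<p} = ennreal p"
proof -
  have "{0..1} \<inter> {..<p} = {0..<p}"
    using assms by auto
  then show ?thesis
    using assms by (simp add: unif_def divide_ennreal_def)
qed

text \<open>
  On the set where \<open>f\<close> exceeds \<open>g\<close> the difference \<open>f - g\<close> has integral zero; finiteness of the
  integral of \<open>g\<close> allows the subtraction.
\<close>

lemma AE_le_if_set_nn_integral_le:
  fixes f g :: "'a \<Rightarrow> ennreal"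
  assumes f[measurable]: "f \<in> borel_measurable \<nu>" and g[measurable]: "g \<in> borel_measurable \<nu>"
    and fin: "(\<integral>\<^sup>+z. g z \<partial>\<nu>) < \<top>"
    and le: "\<And>A. A \<in> sets \<nu> \<Longrightarrow> (\<integral>\<^sup>+z\<in>A. f z \<partial>\<nu>) \<le> (\<integral>\<^sup>+z\<in>A. g z \<partial>\<nu>)"
  shows "AE z in \<nu>. f z \<le> g z"
proof -
  define N where "N = {z \<in> space \<nu>. g z < f z}"
  have N[measurable]: "N \<in> sets \<nu>" unfolding N_def by measurable
  have fin_N: "(\<integral>\<^sup>+z\<in>N. g z \<partial>\<nu>) < \<top>"
    using fin by (rule le_less_trans[rotated]) (auto intro!: nn_integral_mono split: split_indicator)
  have "(\<integral>\<^sup>+z. (f z - g z) * indicator N z \<partial>\<nu>)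
      = (\<integral>\<^sup>+z. f z * indicator N z - g z * indicator N z \<partial>\<nu>)"
    by (intro nn_integral_cong) (auto split: split_indicator)
  also have "\<dots> = (\<integral>\<^sup>+z\<in>N. f z \<partial>\<nu>) - (\<integral>\<^sup>+z\<in>N. g z \<partial>\<nu>)"
    using fin_N by (intro nn_integral_diff) (auto simp: N_def split: split_indicator)
  also have "\<dots> = 0" using le[OF N] le_less_trans[OF le[OF N] fin_N] by (simp add: diff_eq_0_iff_ennreal)
  finally have "AE z in \<nu>. (f z - g z) * indicator N z = 0"
    by (subst (asm) nn_integral_0_iff_AE) auto
  then show ?thesis
    using AE_space by eventually_elim (auto simp: N_def diff_eq_0_iff_ennreal split: split_indicator_asm)
qed

text \<open>
  A measure below \<open>\<nu>\<close> has a Radon-Nikodym density, which is almost everywhere at most \<open>1\<close>; truncation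
  makes the bound hold everywhere, so that the density can be used as an acceptance probability at
  every point.
\<close>

lemma ex_bounded_density:
  assumes "finite_measure \<nu>" and sets: "sets \<rho> = sets \<nu>"
    and le: "\<And>A. A \<in> sets \<nu> \<Longrightarrow> emeasure \<rho> A \<le> emeasure \<nu> A"
  obtains f :: "'a \<Rightarrow> real" where "f \<in> borel_measurable \<nu>" "\<And>z. 0 \<le> f z" "\<And>z. f z \<le> 1"
    "density \<nu> (\<lambda>z. ennreal (f z)) = \<rho>"
proof -
  interpret finite_measure \<nu> by fact
  have "absolutely_continuous \<nu> \<rho>"
    unfolding absolutely_continuous_def null_sets_def using le sets
    by (auto simp flip: le_zero_eq intro: order_trans)
  then obtain g where g[measurable]: "g \<in> borel_measurable \<nu>" and \<rho>: "density \<nu> g = \<rho>"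
    using Radon_Nikodym sets by blast
  have le1: "AE z in \<nu>. g z \<le> 1"
  proof (rule AE_le_if_set_nn_integral_le)
    show "(\<integral>\<^sup>+z\<in>A. g z \<partial>\<nu>) \<le> (\<integral>\<^sup>+z\<in>A. 1 \<partial>\<nu>)" if "A \<in> sets \<nu>" for A
      using le[OF that] that by (simp add: \<rho>[symmetric] emeasure_density)
  qed (auto simp: emeasure_eq_measure)
  define f where "f z = enn2real (min 1 (g z))" for z
  show thesis
  proof
    show "f \<in> borel_measurable \<nu>" unfolding f_def by measurable
    show "0 \<le> f z" for z by (simp add: f_def)
    show "f z \<le> 1" for z unfolding f_def
      using enn2real_mono[of "min 1 (g z)" 1] by simp
    have "density \<nu> (\<lambda>z. ennreal (f z)) = density \<nu> g"
    proof (rule density_cong)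
      show "AE z in \<nu>. ennreal (f z) = g z"
        using le1 by eventually_elim (auto simp: f_def min_absorb2 intro!: ennreal_enn2real intro: le_less_trans)
    qed (auto simp: f_def)
    then show "density \<nu> (\<lambda>z. ennreal (f z)) = \<rho>" using \<rho> by simp
  qed
qed

section \<open>Coding a Polish space by real numbers\<close>

text \<open>
  The \<open>k\<close>-th remainder in the greedy expansion in base \<open>4\<close> with digits \<open>0\<close> and \<open>1\<close>; the \<open>k\<close>-th digit
  is \<open>1\<close> if and only if this remainder is at least \<open>1/4\<close>.
\<close>

primrec expand4 :: "nat \<Rightarrow> real \<Rightarrow> real" where
  "expand4 0 x = x"
| "expand4 (Suc k) x = 4 * expand4 k x - of_bool (expand4 k x \<ge> 1/4)"

lemma expand4_measurable [measurable]: "expand4 k \<in> borel_measurable borel"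
  by (induction k) (simp_all add: of_bool_def)

text \<open>
  In base \<open>4\<close> a tail of digits \<open>0\<close> and \<open>1\<close> sums to at most \<open>1/3\<close>, so a remainder with leading digit
  \<open>0\<close> is at most \<open>1/12\<close> and one with leading digit \<open>1\<close> at least \<open>1/4\<close>. Hence no carry can occur (as
  it does in base \<open>2\<close>), and digits are recovered measurably.
\<close>

lemma expand4_suminf:
  fixes b :: "nat \<Rightarrow> bool"
  shows "expand4 k (\<Sum>j. of_bool (b j) / 4 ^ Suc j) \<ge> 1/4 \<longleftrightarrow> b k"
proof -
  define tail :: "nat \<Rightarrow> real" where "tail k = (\<Sum>j. of_bool (b (j + k)) / 4 ^ Suc j)" for k
  have geo: "(\<lambda>j. (1/4) ^ Suc j :: real) sums (1/3)"
    using sums_mult[OF geometric_sums[of "1/4::real"], of "1/4"] by simp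
  have summ: "summable (\<lambda>j. of_bool (b (j + k)) / 4 ^ Suc j :: real)" for k
    by (rule summable_comparison_test'[OF sums_summable[OF geo], of 0]) (auto simp: power_divide)
  have nonneg: "0 \<le> tail k" for k
    unfolding tail_def by (intro suminf_nonneg summ) auto
  have le: "tail k \<le> 1/3" for k
    unfolding tail_def sums_unique[OF geo]
    by (intro suminf_le summ sums_summable[OF geo]) (auto simp: power_divide)
  have step: "tail k = (of_bool (b k) + tail (Suc k)) / 4" for k
  proof -
    have "tail k = of_bool (b k) / 4 + (\<Sum>j. of_bool (b (Suc j + k)) / 4 ^ Suc (Suc j))"
      using suminf_split_head[OF summ[of k]] by (simp add: tail_def)
    also have "(\<Sum>j. of_bool (b (Suc j + k)) / 4 ^ Suc (Suc j)) = (\<Sum>j. (of_bool (b (j + Suc k)) / 4 ^ Suc j) / 4 :: real)"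
      by (simp add: field_simps)
    also have "\<dots> = tail (Suc k) / 4"
      unfolding tail_def by (rule suminf_divide[OF summ])
    finally show ?thesis by (simp add: add_divide_distrib)
  qed
  have digit: "tail k \<ge> 1/4 \<longleftrightarrow> b k" for k
    using step[of k] nonneg[of "Suc k"] le[of "Suc k"] by (auto simp: of_bool_def split: if_splits)
  have "expand4 k (tail 0) = tail k" for k
  proof (induction k)
    case (Suc k)
    then show ?case using step[of k] digit[of k] by simp
  qed simp
  then show ?thesis
    using digit[of k] by (simp add: tail_def)
qed

text \<open>
  The digits of \<open>c y\<close> record which balls of radius \<open>1 / 2 ^ k\<close> around the points of a countable dense
  set contain \<open>y\<close>. To decode, choose for each \<open>k\<close> the first centre whose ball of radius \<open>1 / 2 ^ k\<close>
  is marked: these centres converge to \<open>y\<close>. Completeness makes the set where the chosen centres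
  converge measurable, as the set where they form a Cauchy sequence, and this yields a measurable
  decoder on the whole real line.
\<close>

lemma polish_real_code:
  obtains c :: "'b::polish_space \<Rightarrow> real" and d :: "real \<Rightarrow> 'b"
  where "c \<in> borel_measurable borel" "d \<in> borel_measurable borel" "\<And>y. d (c y) = y"
proof -
  obtain D :: "'b set" where "countable D" and D: "\<And>U. open U \<Longrightarrow> U \<noteq> {} \<Longrightarrow> \<exists>y\<in>D. y \<in> U"
    using countable_dense_setE by blast
  define p where "p = from_nat_into D"
  have "D \<noteq> {}" using D[of UNIV] by auto
  then have range_p: "range p = D"
    using \<open>countable D\<close> by (simp add: p_def)
  have dense: "\<exists>i. dist y (p i) < 1 / 2 ^ k" for y :: 'b and k :: nat
    using D[of "ball y (1 / 2 ^ k)"] unfolding range_p[symmetric] by (auto simp: not_le)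
  define b where "b y j = (case prod_decode j of (i, k) \<Rightarrow> dist y (p i) < 1 / 2 ^ k)" for y j
  define c where "c y = (\<Sum>j. of_bool (b y j) / 4 ^ Suc j :: real)" for y
  define approx where
    "approx k x = p (LEAST i. expand4 (prod_encode (i, k)) x \<ge> 1/4)" for k :: nat and x
  \<comment> \<open>off the range of \<open>c\<close> the centres may fail to converge; a constant makes \<open>d\<close> a limit of measurable functions everywhere\<close>
  define d where "d x = lim (\<lambda>k. if Cauchy (\<lambda>k. approx k x) then approx k x else p 0)" for x
  have [measurable]: "(\<lambda>y. b y j) \<in> measurable borel (count_space UNIV)" for j
    unfolding b_def by (cases "prod_decode j") simp
  have c: "c \<in> borel_measurable borel"
    unfolding c_def of_bool_def by measurable
  have approx[measurable]: "approx k \<in> borel_measurable borel" for k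
    unfolding approx_def by measurable
  have d: "d \<in> borel_measurable borel"
  proof (rule borel_measurable_LIMSEQ_metric)
    have [measurable]: "Measurable.pred borel (\<lambda>x. Cauchy (\<lambda>k. approx k x))"
      using sets_Collect_Cauchy[of approx borel] by (simp add: pred_def)
    show "(\<lambda>x. if Cauchy (\<lambda>k. approx k x) then approx k x else p 0) \<in> borel_measurable borel" for k
      by measurable
    show "(\<lambda>k. if Cauchy (\<lambda>k. approx k x) then approx k x else p 0) \<longlonglongrightarrow> d x" for x
      unfolding d_def convergent_LIMSEQ_iff[symmetric]
      by (cases "Cauchy (\<lambda>k. approx k x)") (auto simp: Cauchy_convergent_iff convergent_const)
  qed
  have "d (c y) = y" for y
  proof -
    have close: "dist (approx k (c y)) y < 1 / 2 ^ k" for k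
    proof -
      have "approx k (c y) = p (LEAST i. dist y (p i) < 1 / 2 ^ k)"
        unfolding approx_def c_def expand4_suminf by (simp add: b_def)
      then show ?thesis
        using LeastI_ex[OF dense[of y k]] by (simp add: dist_commute)
    qed
    have lim: "(\<lambda>k. approx k (c y)) \<longlonglongrightarrow> y"
    proof (rule metric_tendsto_imp_tendsto)
      show "(\<lambda>k. (1/2) ^ k :: real) \<longlonglongrightarrow> 0" by (intro LIMSEQ_power_zero) simp
      show "\<forall>\<^sub>F k in sequentially. dist (approx k (c y)) y \<le> dist ((1/2::real) ^ k) 0"
        using close by (intro always_eventually) (auto simp: power_divide less_imp_le)
    qed
    then show ?thesis
      unfolding d_def using LIMSEQ_imp_Cauchy[OF lim] by (simp add: limI)
  qed
  with c d show thesis by (rule that)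
qed

section \<open>Conditional laws as functions of uniform noise\<close>

text \<open>
  Let \<open>F q z\<close> be a version of the conditional probability of \<open>c < q\<close> given \<open>\<theta> = z\<close>. For \<open>u\<close> uniform
  on \<open>[0, 1]\<close>, the infimum \<open>\<Phi> (z, u)\<close> of the rational \<open>q\<close> with \<open>u < F q z\<close> has the conditional law of
  \<open>c\<close> given \<open>\<theta> = z\<close>. Restricting \<open>q\<close> to the rationals leaves only countably many exceptional null sets for
  the monotonicity of \<open>F\<close> in \<open>q\<close>. In the extended reals the infimum exists for every \<open>u\<close>.
\<close>

lemma conditional_quantile:
  fixes c :: "'b \<Rightarrow> ereal"
  assumes "prob_space \<beta>" and \<theta>[measurable]: "\<theta> \<in> measurable \<beta> N"
    and c[measurable]: "c \<in> borel_measurable \<beta>"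
  obtains \<Phi> :: "'c \<times> real \<Rightarrow> ereal" where "\<Phi> \<in> measurable (N \<Otimes>\<^sub>M borel) borel"
    and "distr (distr \<beta> N \<theta> \<Otimes>\<^sub>M unif) (N \<Otimes>\<^sub>M borel) (\<lambda>(z, u). (z, \<Phi> (z, u)))
      = distr \<beta> (N \<Otimes>\<^sub>M borel) (\<lambda>\<omega>. (\<theta> \<omega>, c \<omega>))"
proof -
  interpret prob_space \<beta> by fact
  interpret U: prob_space unif by (rule prob_space_unif)
  define \<nu> where "\<nu> = distr \<beta> N \<theta>"
  interpret \<nu>: prob_space \<nu> unfolding \<nu>_def by (rule prob_space_distr) simp
  have sets_\<nu>[measurable_cong, simp]: "sets \<nu> = sets N" and space_\<nu>[simp]: "space \<nu> = space N"
    by (simp_all add: \<nu>_def)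
  define \<rho> where "\<rho> t = distr (density \<beta> (indicator {\<omega> \<in> space \<beta>. c \<omega> < t})) N \<theta>" for t :: ereal
  have \<rho>: "emeasure (\<rho> t) C = emeasure \<beta> {\<omega> \<in> space \<beta>. \<theta> \<omega> \<in> C \<and> c \<omega> < t}" if C: "C \<in> sets N" for t C
  proof -
    have [measurable]: "C \<in> sets N" by fact
    have "emeasure (\<rho> t) C = (\<integral>\<^sup>+\<omega>. indicator {\<omega> \<in> space \<beta>. c \<omega> < t} \<omega> * indicator (\<theta> -` C \<inter> space \<beta>) \<omega> \<partial>\<beta>)"
      unfolding \<rho>_def by (simp add: emeasure_distr emeasure_density)
    also have "\<dots> = (\<integral>\<^sup>+\<omega>. indicator {\<omega> \<in> space \<beta>. \<theta> \<omega> \<in> C \<and> c \<omega> < t} \<omega> \<partial>\<beta>)"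
      by (intro nn_integral_cong) (auto split: split_indicator)
    finally show ?thesis by simp
  qed
  have "\<exists>f :: 'c \<Rightarrow> real. f \<in> borel_measurable \<nu> \<and> (\<forall>z. 0 \<le> f z \<and> f z \<le> 1) \<and> density \<nu> (\<lambda>z. ennreal (f z)) = \<rho> t" for t
  proof (rule ex_bounded_density[of \<nu> "\<rho> t"])
    show "emeasure (\<rho> t) C \<le> emeasure \<nu> C" if "C \<in> sets \<nu>" for C
      using that by (auto simp: \<rho> \<nu>_def emeasure_distr intro!: emeasure_mono)
  qed (auto simp: \<rho>_def \<nu>.finite_measure_axioms)
  then obtain F where F[measurable]: "\<And>t. F t \<in> borel_measurable \<nu>"
    and F01: "\<And>t z. 0 \<le> F t z" "\<And>t z. F t z \<le> 1"
    and dens: "\<And>t. density \<nu> (\<lambda>z. ennreal (F t z)) = \<rho> t"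
    by metis
  have [measurable]: "F t \<in> borel_measurable N" for t
    using F[of t] by simp
  have F_int: "(\<integral>\<^sup>+z\<in>C. F t z \<partial>\<nu>) = emeasure \<beta> {\<omega> \<in> space \<beta>. \<theta> \<omega> \<in> C \<and> c \<omega> < t}" if "C \<in> sets N" for C t
    using \<rho>[OF that, of t] that by (simp add: dens[symmetric] emeasure_density)
  define Q :: "ereal set" where "Q = ereal ` \<rat>"
  have Q: "countable Q" "Q \<noteq> {}"
    by (auto simp: Q_def countable_rat)
  have Q_dense: "\<exists>q\<in>Q. x < q \<and> q < y" if less: "x < y" for x y :: ereal
  proof -
    obtain a where a: "x < ereal a" "ereal a < y"
      using ereal_dense2[OF less] by blast
    obtain b where b: "ereal a < ereal b" "ereal b < y"
      using ereal_dense2[OF a(2)] by blast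
    obtain q where "q \<in> \<rat>" "a < q" "q < b"
      using Rats_dense_in_real[of a b] b by auto
    then have "ereal q \<in> Q" "ereal a < ereal q" "ereal q < ereal b"
      by (simp_all add: Q_def)
    with less_trans[OF a(1)] less_trans[OF _ b(2)] show ?thesis
      by blast
  qed
  define \<Phi> where "\<Phi> = (\<lambda>(z, u). INF q\<in>Q. if u < F q z then q else \<infinity>)"
  have \<Phi>_less: "\<Phi> (z, u) < t \<longleftrightarrow> (\<exists>q\<in>Q. q < t \<and> u < F q z)" for z u t
    unfolding \<Phi>_def case_prod_conv INF_less_iff by auto
  have \<Phi>[measurable]: "\<Phi> \<in> measurable (N \<Otimes>\<^sub>M borel) borel"
    unfolding \<Phi>_def case_prod_unfold using Q(1) by measurable
  have mono: "AE z in \<nu>. \<forall>q\<in>Q. \<forall>q'\<in>Q. q \<le> q' \<longrightarrow> F q z \<le> F q' z"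
  proof (intro AE_ball_countable[THEN iffD2] Q ballI)
    fix q q' show "AE z in \<nu>. q \<le> q' \<longrightarrow> F q z \<le> F q' z"
    proof (cases "q \<le> q'")
      case True
      have "AE z in \<nu>. ennreal (F q z) \<le> ennreal (F q' z)"
      proof (rule AE_le_if_set_nn_integral_le)
        show "(\<integral>\<^sup>+z\<in>C. F q z \<partial>\<nu>) \<le> (\<integral>\<^sup>+z\<in>C. F q' z \<partial>\<nu>)" if "C \<in> sets \<nu>" for C
          using that True by (auto simp: F_int intro!: emeasure_mono)
        show "(\<integral>\<^sup>+z. F q' z \<partial>\<nu>) < \<top>"
          using nn_integral_mono[of \<nu> "\<lambda>z. ennreal (F q' z)" "\<lambda>_. 1"] F01(2)
          by (auto simp: \<nu>.emeasure_eq_measure intro: le_less_trans)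
      qed simp_all
      then show ?thesis using F01 by (simp add: ennreal_le_iff)
    qed simp
  qed
  let ?L = "distr (\<nu> \<Otimes>\<^sub>M unif) (N \<Otimes>\<^sub>M borel) (\<lambda>(z, u). (z, \<Phi> (z, u)))"
  let ?R = "distr \<beta> (N \<Otimes>\<^sub>M borel) (\<lambda>\<omega>. (\<theta> \<omega>, c \<omega>))"
  have R_eq: "emeasure ?R (C \<times> B) = emeasure \<beta> {\<omega> \<in> space \<beta>. \<theta> \<omega> \<in> C \<and> c \<omega> \<in> B}"
    if "C \<in> sets N" "B \<in> sets borel" for C B
    using that by (subst emeasure_distr) (auto intro!: arg_cong[where f="emeasure \<beta>"])
  have L_eq: "emeasure ?L (C \<times> B) = (\<integral>\<^sup>+z. indicator C z * emeasure unif {u. \<Phi> (z, u) \<in> B} \<partial>\<nu>)"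
    if [measurable]: "C \<in> sets N" "B \<in> sets borel" for C B
  proof -
    have G: "(\<lambda>(z, u). (z, \<Phi> (z, u))) \<in> measurable (\<nu> \<Otimes>\<^sub>M unif) (N \<Otimes>\<^sub>M borel)"
      by measurable
    have "emeasure ?L (C \<times> B)
        = emeasure (\<nu> \<Otimes>\<^sub>M unif) ((\<lambda>(z, u). (z, \<Phi> (z, u))) -` (C \<times> B) \<inter> space (\<nu> \<Otimes>\<^sub>M unif))"
      by (subst emeasure_distr) simp_all
    also have "\<dots> = (\<integral>\<^sup>+z. emeasure unif
        (Pair z -` ((\<lambda>(z, u). (z, \<Phi> (z, u))) -` (C \<times> B) \<inter> space (\<nu> \<Otimes>\<^sub>M unif))) \<partial>\<nu>)"
      by (rule U.emeasure_pair_measure_alt, rule measurable_sets[OF G]) simp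
    also have "\<dots> = (\<integral>\<^sup>+z. indicator C z * emeasure unif {u. \<Phi> (z, u) \<in> B} \<partial>\<nu>)"
    proof (intro nn_integral_cong)
      fix z assume "z \<in> space \<nu>"
      then have "Pair z -` ((\<lambda>(z, u). (z, \<Phi> (z, u))) -` (C \<times> B) \<inter> space (\<nu> \<Otimes>\<^sub>M unif))
          = (if z \<in> C then {u. \<Phi> (z, u) \<in> B} else {})"
        by (auto simp: space_pair_measure)
      then show "emeasure unif (Pair z -` ((\<lambda>(z, u). (z, \<Phi> (z, u))) -` (C \<times> B) \<inter> space (\<nu> \<Otimes>\<^sub>M unif)))
          = indicator C z * emeasure unif {u. \<Phi> (z, u) \<in> B}"
        by simp
    qed
    finally show ?thesis .
  qed
  \<comment> \<open>\<open>{..<t}\<close> is the increasing union of \<open>{..<s n}\<close> for rational \<open>s n\<close>, so monotone convergence carries the defining property of \<open>F\<close> over to \<open>t\<close>\<close>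
  have below: "emeasure ?L (C \<times> {..<t}) = emeasure ?R (C \<times> {..<t})" if C[measurable]: "C \<in> sets N" for C t
  proof (cases "{q \<in> Q. q < t} = {}")
    case True
    then have "\<not> c \<omega> < t" for \<omega>
      using Q_dense[of "c \<omega>" t] by auto
    moreover have "\<not> \<Phi> (z, u) < t" for z u
      using True by (auto simp: \<Phi>_less)
    ultimately show ?thesis
      by (subst L_eq, simp, simp, subst R_eq) auto
  next
    case False
    define r where "r = from_nat_into {q \<in> Q. q < t}"
    have range_r: "range r = {q \<in> Q. q < t}"
      unfolding r_def using False Q by (intro range_from_nat_into) auto
    \<comment> \<open>the rationals below \<open>t\<close>, made increasing by running maxima of an enumeration\<close>
    define s where "s n = Max (r ` {..n})" for n
    have s_in: "s n \<in> Q \<and> s n < t" for n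
    proof -
      have "s n \<in> r ` {..n}" unfolding s_def by (intro Max_in) auto
      then show ?thesis using range_r by auto
    qed
    have s_mono: "s m \<le> s n" if "m \<le> n" for m n
      unfolding s_def using that by (intro Max_mono) auto
    have s_ge: "\<exists>n. q \<le> s n" if q: "q \<in> Q" "q < t" for q
    proof -
      have "q \<in> range r" using q by (simp add: range_r)
      then obtain n where "q = r n" by blast
      then show ?thesis unfolding s_def by (intro exI[of _ n] Max_ge) auto
    qed
    have unif_SUP: "AE z in \<nu>. emeasure unif {u. \<Phi> (z, u) < t} = (SUP n. ennreal (F (s n) z))"
      using mono
    proof eventually_elim
      case (elim z)
      have "{u. \<Phi> (z, u) < t} = (\<Union>n. {..<F (s n) z})"
      proof (intro set_eqI iffI)
        fix u assume "u \<in> {u. \<Phi> (z, u) < t}"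
        then obtain q where q: "q \<in> Q" "q < t" "u < F q z" by (auto simp: \<Phi>_less)
        obtain n where "q \<le> s n" using s_ge[OF q(1,2)] by blast
        then have "F q z \<le> F (s n) z" using elim q(1) s_in[of n] by blast
        with q(3) have "u < F (s n) z" by simp
        then show "u \<in> (\<Union>n. {..<F (s n) z})" by blast
      next
        fix u assume "u \<in> (\<Union>n. {..<F (s n) z})"
        then show "u \<in> {u. \<Phi> (z, u) < t}" using s_in by (auto simp: \<Phi>_less)
      qed
      moreover have "incseq (\<lambda>n. {..<F (s n) z})"
      proof (rule incseq_SucI)
        fix n
        have "F (s n) z \<le> F (s (Suc n)) z"
          using elim s_in[of n] s_in[of "Suc n"] s_mono[of n "Suc n"] by simp
        then show "{..<F (s n) z} \<subseteq> {..<F (s (Suc n)) z}" by auto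
      qed
      ultimately have "emeasure unif {u. \<Phi> (z, u) < t} = (SUP n. emeasure unif {..<F (s n) z})"
        by (subst SUP_emeasure_incseq) auto
      then show ?case
        using F01 by (simp add: emeasure_unif_lessThan)
    qed
    have "emeasure ?L (C \<times> {..<t}) = (\<integral>\<^sup>+z. indicator C z * emeasure unif {u. \<Phi> (z, u) < t} \<partial>\<nu>)"
      by (subst L_eq) auto
    also have "\<dots> = (\<integral>\<^sup>+z. (SUP n. ennreal (F (s n) z) * indicator C z) \<partial>\<nu>)"
    proof (rule nn_integral_cong_AE)
      show "AE z in \<nu>. indicator C z * emeasure unif {u. \<Phi> (z, u) < t}
          = (SUP n. ennreal (F (s n) z) * indicator C z)"
        using unif_SUP by eventually_elim (simp split: split_indicator)
    qed
    also have "\<dots> = (SUP n. \<integral>\<^sup>+z\<in>C. F (s n) z \<partial>\<nu>)"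
    proof (rule nn_integral_monotone_convergence_SUP_AE)
      fix n show "AE z in \<nu>. ennreal (F (s n) z) * indicator C z \<le> ennreal (F (s (Suc n)) z) * indicator C z"
        using mono
      proof eventually_elim
        case (elim z)
        then have "F (s n) z \<le> F (s (Suc n)) z"
          using s_in[of n] s_in[of "Suc n"] s_mono[of n "Suc n"] by simp
        then show ?case by (auto split: split_indicator intro: ennreal_leI)
      qed
    qed simp
    also have "\<dots> = (SUP n. emeasure \<beta> {\<omega> \<in> space \<beta>. \<theta> \<omega> \<in> C \<and> c \<omega> < s n})"
      by (simp add: F_int C)
    also have "\<dots> = emeasure \<beta> (\<Union>n. {\<omega> \<in> space \<beta>. \<theta> \<omega> \<in> C \<and> c \<omega> < s n})"
      proof (rule SUP_emeasure_incseq)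
      show "incseq (\<lambda>n. {\<omega> \<in> space \<beta>. \<theta> \<omega> \<in> C \<and> c \<omega> < s n})"
        unfolding incseq_def using s_mono by (blast intro: less_le_trans)
    qed auto
    also have "(\<Union>n. {\<omega> \<in> space \<beta>. \<theta> \<omega> \<in> C \<and> c \<omega> < s n}) = {\<omega> \<in> space \<beta>. \<theta> \<omega> \<in> C \<and> c \<omega> < t}"
    proof (intro set_eqI iffI)
      fix \<omega> assume \<omega>: "\<omega> \<in> {\<omega> \<in> space \<beta>. \<theta> \<omega> \<in> C \<and> c \<omega> < t}"
      then obtain q where q: "q \<in> Q" "c \<omega> < q" "q < t" using Q_dense[of "c \<omega>" t] by auto
      obtain n where "q \<le> s n" using s_ge[OF q(1,3)] by blast
      with q(2) have "c \<omega> < s n" by (rule less_le_trans)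
      with \<omega> show "\<omega> \<in> (\<Union>n. {\<omega> \<in> space \<beta>. \<theta> \<omega> \<in> C \<and> c \<omega> < s n})" by auto
    qed (auto intro: less_trans[OF _ s_in[THEN conjunct2]])
    also have "emeasure \<beta> {\<omega> \<in> space \<beta>. \<theta> \<omega> \<in> C \<and> c \<omega> < t} = emeasure ?R (C \<times> {..<t})"
      by (simp add: R_eq)
    finally show ?thesis .
  qed
  have total: "emeasure ?L (C \<times> UNIV) = emeasure ?R (C \<times> UNIV)" if C[measurable]: "C \<in> sets N" for C
  proof -
    have "emeasure ?L (C \<times> UNIV) = (\<integral>\<^sup>+z. indicator C z * 1 \<partial>\<nu>)"
      using U.emeasure_space_1 by (subst L_eq) auto
    also have "\<dots> = emeasure \<beta> {\<omega> \<in> space \<beta>. \<theta> \<omega> \<in> C \<and> c \<omega> \<in> UNIV}"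
      by (auto simp: \<nu>_def emeasure_distr intro!: arg_cong[where f="emeasure \<beta>"])
    finally show ?thesis by (simp add: R_eq)
  qed
  \<comment> \<open>the half-lines \<open>{..<t}\<close> do not cover the extended reals, hence the additional generator \<open>UNIV\<close>\<close>
  let ?B = "insert UNIV (range lessThan) :: ereal set set"
  let ?E = "{C \<times> B | C B. C \<in> sets N \<and> B \<in> ?B}"
  have gen: "sets (N \<Otimes>\<^sub>M borel) = sigma_sets (space N \<times> UNIV) ?E"
  proof -
    have b: "sets (borel :: ereal measure) = sets (sigma UNIV ?B)"
      unfolding borel_Iio
      by (simp, rule sigma_sets_eqI) (auto intro: sigma_sets.Basic sigma_sets_top)
    have "sets (N \<Otimes>\<^sub>M borel) = sets (sigma (space N) (sets N) \<Otimes>\<^sub>M sigma UNIV ?B)"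
      using b by (intro sets_pair_measure_cong) (auto simp: sets.space_closed sets.sigma_sets_eq)
    also have "\<dots> = sets (sigma (space N \<times> UNIV) ?E)"
    proof (subst sigma_prod)
      show "\<exists>E\<subseteq>sets N. countable E \<and> space N = \<Union>E"
        by (intro exI[of _ "{space N}"]) auto
      show "\<exists>E\<subseteq>?B. countable E \<and> UNIV = \<Union>E"
        by (intro exI[of _ "{UNIV}"]) auto
    qed (auto simp: sets.space_closed)
    also have "\<dots> = sigma_sets (space N \<times> UNIV) ?E"
      using sets.sets_into_space by (intro sets_measure_of) blast
    finally show ?thesis .
  qed
  have "?L = ?R"
  proof (rule measure_eqI_generator_eq[where E="?E" and A="\<lambda>_. space N \<times> UNIV" and \<Omega>="space N \<times> UNIV"])
    show "Int_stable ?E"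
    proof (rule Int_stableI)
      fix a b assume "a \<in> ?E" "b \<in> ?E"
      then obtain C B C' B' where ab: "a = C \<times> B" "b = C' \<times> B'"
        and C: "C \<in> sets N" "C' \<in> sets N" and B: "B \<in> ?B" "B' \<in> ?B" by blast
      have "{..<x} \<inter> {..<y} = {..<min x y}" for x y :: ereal
        by auto
      then have "B \<inter> B' \<in> ?B"
        using B by auto
      moreover have "a \<inter> b = (C \<inter> C') \<times> (B \<inter> B')"
        using ab by auto
      moreover have "C \<inter> C' \<in> sets N"
        using C by auto
      ultimately show "a \<inter> b \<in> ?E" by blast
    qed
    show "?E \<subseteq> Pow (space N \<times> UNIV)" using sets.sets_into_space by blast
    show "emeasure ?L X = emeasure ?R X" if "X \<in> ?E" for X
    proof -
      obtain C B where "X = C \<times> B" "C \<in> sets N" "B \<in> ?B"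
        using \<open>X \<in> ?E\<close> by blast
      then show ?thesis
        using below total by fast
    qed
    show "emeasure ?L (space N \<times> UNIV) \<noteq> \<infinity>"
      by (subst total) (auto simp: R_eq)
  qed (use gen in auto)
  with \<Phi> show thesis unfolding \<nu>_def by (rule that)
qed

text \<open>
  A random element \<open>\<omega>\<close> of a Polish space is, jointly with \<open>\<theta> \<omega>\<close>, distributed as a function of
  \<open>\<theta> \<omega>\<close> and independent uniform noise: decode the conditional quantile of its real code. This
  plays the role of a regular conditional law of \<open>\<omega>\<close> given \<open>\<theta> \<omega>\<close>.
\<close>

lemma noise_outsourcing:
  fixes \<beta> :: "'b::polish_space measure"
  assumes "prob_space \<beta>" and sets_\<beta>[measurable_cong, simp]: "sets \<beta> = sets borel"
    and \<theta>[measurable]: "\<theta> \<in> measurable \<beta> N"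
  obtains \<Psi> :: "'c \<times> real \<Rightarrow> 'b" where "\<Psi> \<in> measurable (N \<Otimes>\<^sub>M borel) borel"
    and "distr (distr \<beta> N \<theta> \<Otimes>\<^sub>M unif) (N \<Otimes>\<^sub>M borel) (\<lambda>(z, u). (z, \<Psi> (z, u)))
      = distr \<beta> (N \<Otimes>\<^sub>M borel) (\<lambda>\<omega>. (\<theta> \<omega>, \<omega>))"
proof -
  obtain c :: "'b \<Rightarrow> real" and d where c[measurable]: "c \<in> borel_measurable borel"
    and d[measurable]: "d \<in> borel_measurable borel" and dc: "\<And>y. d (c y) = y"
    using polish_real_code by blast
  obtain \<Phi> where \<Phi>[measurable]: "\<Phi> \<in> measurable (N \<Otimes>\<^sub>M borel) borel"
    and law: "distr (distr \<beta> N \<theta> \<Otimes>\<^sub>M unif) (N \<Otimes>\<^sub>M borel) (\<lambda>(z, u). (z, \<Phi> (z, u)))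
      = distr \<beta> (N \<Otimes>\<^sub>M borel) (\<lambda>\<omega>. (\<theta> \<omega>, ereal (c \<omega>)))"
    using conditional_quantile[of \<beta> \<theta> N "\<lambda>\<omega>. ereal (c \<omega>)"] assms by auto
  define D where "D = (\<lambda>(z :: 'c, x). (z, d (real_of_ereal x)))"
  have D[measurable]: "D \<in> measurable (N \<Otimes>\<^sub>M borel) (N \<Otimes>\<^sub>M borel)"
    unfolding D_def by measurable
  show thesis
  proof
    show "(\<lambda>p. d (real_of_ereal (\<Phi> p))) \<in> measurable (N \<Otimes>\<^sub>M borel) borel" by measurable
    have "distr (distr (distr \<beta> N \<theta> \<Otimes>\<^sub>M unif) (N \<Otimes>\<^sub>M borel) (\<lambda>(z, u). (z, \<Phi> (z, u)))) (N \<Otimes>\<^sub>M borel) D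
        = distr (distr \<beta> (N \<Otimes>\<^sub>M borel) (\<lambda>\<omega>. (\<theta> \<omega>, ereal (c \<omega>)))) (N \<Otimes>\<^sub>M borel) D"
      by (simp only: law)
    then show "distr (distr \<beta> N \<theta> \<Otimes>\<^sub>M unif) (N \<Otimes>\<^sub>M borel) (\<lambda>(z, u). (z, d (real_of_ereal (\<Phi> (z, u)))))
        = distr \<beta> (N \<Otimes>\<^sub>M borel) (\<lambda>\<omega>. (\<theta> \<omega>, \<omega>))"
      by (simp add: distr_distr D_def o_def case_prod_unfold dc)
  qed
qed

section \<open>Coupling two laws with overlapping images\<close>

text \<open>
  Let \<open>f\<close> and \<open>g\<close> be the densities of \<open>\<rho>\<close> with respect to the two image laws. A sample point consists
  of \<open>\<omega>\<close>, the uniform variable that decides on acceptance of \<open>\<theta> \<omega>\<close> (with probability \<open>f (\<theta> \<omega>)\<close>), a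
  sample of the normalized residual law with density \<open>1 - g\<close>, and the noise for \<open>\<Psi>\<close>. The accepted
  part contributes \<open>\<rho>\<close> to the law of the outcome \<open>Z\<close> and the rejected part, of the same mass
  \<open>1 - \<rho> UNIV\<close> as the residual law, contributes the residual, so \<open>Z\<close> is distributed as the image of
  \<open>\<beta>\<close>. The bound \<open>\<rho> UNIV < 1\<close> makes the normalization possible.
\<close>

lemma acceptance_coupling:
  fixes \<theta> :: "'a \<Rightarrow> 'c::polish_space" and \<theta>' :: "'b::polish_space \<Rightarrow> 'c"
  assumes \<alpha>: "prob_space \<alpha>" and \<beta>: "prob_space \<beta>"
    and sets_\<beta>[measurable_cong, simp]: "sets \<beta> = sets borel"
    and \<theta>[measurable]: "\<theta> \<in> borel_measurable \<alpha>" and \<theta>'[measurable]: "\<theta>' \<in> borel_measurable borel"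
    and sets_\<rho>: "sets \<rho> = sets borel" and \<rho>0: "emeasure \<rho> UNIV \<noteq> 0" and \<rho>1: "emeasure \<rho> UNIV < 1"
    and le: "\<And>B. B \<in> sets borel \<Longrightarrow> emeasure \<rho> B \<le> emeasure (distr \<alpha> borel \<theta>) B"
    and le': "\<And>B. B \<in> sets borel \<Longrightarrow> emeasure \<rho> B \<le> emeasure (distr \<beta> borel \<theta>') B"
  obtains Q :: "((('a \<times> real) \<times> 'c) \<times> real) measure" and X Y
  where "prob_space Q" "X \<in> measurable Q \<alpha>" "Y \<in> borel_measurable Q"
    "distr Q \<alpha> X = \<alpha>" "distr Q borel Y = \<beta>"
    "emeasure Q {\<omega> \<in> space Q. \<theta> (X \<omega>) = \<theta>' (Y \<omega>)} \<noteq> 0"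
proof -
  interpret \<alpha>: prob_space \<alpha> by (fact \<alpha>)
  interpret \<beta>: prob_space \<beta> by (fact \<beta>)
  interpret U: prob_space unif by (rule prob_space_unif)
  have space_\<beta>[simp]: "space \<beta> = UNIV"
    using sets_eq_imp_space_eq[OF sets_\<beta>] by simp
  define \<nu> where "\<nu> = distr \<alpha> borel \<theta>"
  define \<nu>' where "\<nu>' = distr \<beta> borel \<theta>'"
  have [measurable_cong, simp]: "sets \<nu> = sets borel" "sets \<nu>' = sets borel"
    and [simp]: "space \<nu> = UNIV" "space \<nu>' = UNIV"
    by (simp_all add: \<nu>_def \<nu>'_def)
  interpret \<nu>: prob_space \<nu> unfolding \<nu>_def by (rule \<alpha>.prob_space_distr) simp
  interpret \<nu>': prob_space \<nu>' unfolding \<nu>'_def by (rule \<beta>.prob_space_distr) simp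
  obtain f where f[measurable]: "f \<in> borel_measurable \<nu>" and f01: "\<And>z. 0 \<le> f z" "\<And>z. f z \<le> 1"
    and f_dens: "density \<nu> (\<lambda>z. ennreal (f z)) = \<rho>"
    using ex_bounded_density[of \<nu> \<rho>] le sets_\<rho> \<nu>.finite_measure_axioms unfolding \<nu>_def[symmetric] by auto
  obtain g where g[measurable]: "g \<in> borel_measurable \<nu>'" and g01: "\<And>z. 0 \<le> g z" "\<And>z. g z \<le> 1"
    and g_dens: "density \<nu>' (\<lambda>z. ennreal (g z)) = \<rho>"
    using ex_bounded_density[of \<nu>' \<rho>] le' sets_\<rho> \<nu>'.finite_measure_axioms unfolding \<nu>'_def[symmetric] by auto
  have [measurable]: "f \<in> borel_measurable borel" "g \<in> borel_measurable borel"
    using f g by simp_all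
  define \<kappa> where "\<kappa> = density \<nu>' (\<lambda>z. ennreal (1 - g z))"
  have [measurable_cong, simp]: "sets \<kappa> = sets borel" and [simp]: "space \<kappa> = UNIV"
    by (simp_all add: \<kappa>_def)
  have split: "emeasure \<nu>' B = emeasure \<rho> B + emeasure \<kappa> B" if [measurable]: "B \<in> sets borel" for B
  proof -
    have "emeasure \<rho> B + emeasure \<kappa> B = (\<integral>\<^sup>+z. ennreal (g z) * indicator B z + ennreal (1 - g z) * indicator B z \<partial>\<nu>')"
      unfolding \<kappa>_def g_dens[symmetric] by (subst nn_integral_add) (simp_all add: emeasure_density)
    also have "\<dots> = (\<integral>\<^sup>+z. indicator B z \<partial>\<nu>')"
      using g01 by (intro nn_integral_cong) (simp add: indicator_def flip: ennreal_plus)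
    finally show ?thesis by simp
  qed
  have tot: "emeasure \<rho> UNIV + emeasure \<kappa> UNIV = 1"
    using split[of UNIV] \<nu>'.emeasure_space_1 by simp
  have \<kappa>0: "emeasure \<kappa> UNIV \<noteq> 0" and \<kappa>_fin: "emeasure \<kappa> UNIV \<noteq> \<infinity>"
    using tot \<rho>1 by auto
  define K where "K = uniform_measure \<kappa> UNIV"
  have [measurable_cong, simp]: "sets K = sets borel" and [simp]: "space K = UNIV"
    by (simp_all add: K_def)
  interpret K: prob_space K
    unfolding K_def using \<kappa>0 \<kappa>_fin by (intro prob_space_uniform_measure) auto
  have K_eq: "emeasure \<kappa> UNIV * emeasure K B = emeasure \<kappa> B" if [measurable]: "B \<in> sets borel" for B
    unfolding K_def using \<kappa>0 \<kappa>_fin by (simp add: ennreal_times_divide ennreal_mult_divide_eq mult.commute)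
  obtain \<Psi> :: "'c \<times> real \<Rightarrow> 'b" where \<Psi>[measurable]: "\<Psi> \<in> measurable (borel \<Otimes>\<^sub>M borel) borel"
    and law: "distr (\<nu>' \<Otimes>\<^sub>M unif) (borel \<Otimes>\<^sub>M borel) (\<lambda>(z, u). (z, \<Psi> (z, u)))
      = distr \<beta> (borel \<Otimes>\<^sub>M borel) (\<lambda>\<omega>. (\<theta>' \<omega>, \<omega>))"
    unfolding \<nu>'_def by (rule noise_outsourcing[of \<beta> \<theta>' borel]) (simp_all add: \<beta>)
  let ?P1 = "\<alpha> \<Otimes>\<^sub>M unif"
  interpret P1: pair_prob_space \<alpha> unif ..
  define E where "E = {p \<in> space ?P1. snd p < f (\<theta> (fst p))}"
  have E[measurable]: "E \<in> sets ?P1" unfolding E_def by measurable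
  have EB[measurable]: "{p \<in> E. \<theta> (fst p) \<in> B} \<in> sets ?P1" if [measurable]: "B \<in> sets borel" for B
  proof -
    have "{p \<in> E. \<theta> (fst p) \<in> B} = E \<inter> {p \<in> space ?P1. \<theta> (fst p) \<in> B}"
      using sets.sets_into_space[OF E] by auto
    then show ?thesis by (simp only:) measurable
  qed
  have E_eq: "emeasure ?P1 {p \<in> E. \<theta> (fst p) \<in> B} = emeasure \<rho> B" if [measurable]: "B \<in> sets borel" for B
  proof -
    have "emeasure ?P1 {p \<in> E. \<theta> (fst p) \<in> B}
        = (\<integral>\<^sup>+\<omega>. emeasure unif (Pair \<omega> -` {p \<in> E. \<theta> (fst p) \<in> B}) \<partial>\<alpha>)"
      by (rule U.emeasure_pair_measure_alt, rule EB, fact)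
    also have "\<dots> = (\<integral>\<^sup>+\<omega>. ennreal (f (\<theta> \<omega>)) * indicator B (\<theta> \<omega>) \<partial>\<alpha>)"
    proof (intro nn_integral_cong)
      fix \<omega> assume \<omega>: "\<omega> \<in> space \<alpha>"
      show "emeasure unif (Pair \<omega> -` {p \<in> E. \<theta> (fst p) \<in> B}) = ennreal (f (\<theta> \<omega>)) * indicator B (\<theta> \<omega>)"
      proof (cases "\<theta> \<omega> \<in> B")
        case True
        then have "Pair \<omega> -` {p \<in> E. \<theta> (fst p) \<in> B} = {..<f (\<theta> \<omega>)}"
          using \<omega> by (auto simp: E_def space_pair_measure)
        then show ?thesis
          using True f01 by (simp add: emeasure_unif_lessThan)
      qed simp
    qed
    also have "\<dots> = (\<integral>\<^sup>+z. ennreal (f z) * indicator B z \<partial>\<nu>)"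
      unfolding \<nu>_def by (subst nn_integral_distr) auto
    also have "\<dots> = emeasure \<rho> B"
      by (simp add: f_dens[symmetric] emeasure_density)
    finally show ?thesis .
  qed
  let ?P2 = "?P1 \<Otimes>\<^sub>M K"
  interpret P2: pair_prob_space ?P1 K ..
  define Z where "Z = (\<lambda>(p, z). if p \<in> E then \<theta> (fst p) else z)"
  have Z[measurable]: "Z \<in> borel_measurable ?P2"
    unfolding Z_def case_prod_unfold by measurable
  have Z_law: "distr ?P2 borel Z = \<nu>'"
  proof (rule measure_eqI)
    fix B assume "B \<in> sets (distr ?P2 borel Z)"
    then have [measurable]: "B \<in> sets borel" by simp
    have compl: "emeasure ?P1 (space ?P1 - E) = emeasure \<kappa> UNIV"
    proof -
      have "emeasure ?P1 E + emeasure ?P1 (space ?P1 - E) = 1"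
        using P1.P.emeasure_space_1 plus_emeasure[OF E sets.compl_sets[OF E]] sets.sets_into_space[OF E]
        by (simp add: Un_absorb1)
      moreover have "emeasure ?P1 E = emeasure \<rho> UNIV"
        using E_eq[of UNIV] by simp
      ultimately have "emeasure \<rho> UNIV + emeasure ?P1 (space ?P1 - E) = emeasure \<rho> UNIV + emeasure \<kappa> UNIV"
        using tot by (simp only:)
      then show ?thesis
        unfolding ennreal_add_left_cancel using \<rho>1 by auto
    qed
    have "Z -` B \<inter> space ?P2 = {p \<in> E. \<theta> (fst p) \<in> B} \<times> UNIV \<union> (space ?P1 - E) \<times> B"
      using sets.sets_into_space[OF E] by (auto simp: Z_def space_pair_measure split: if_split_asm)
    moreover have "{p \<in> E. \<theta> (fst p) \<in> B} \<times> UNIV \<in> sets ?P2"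
      using EB[of B] sets.top[of K] by (intro pair_measureI) simp_all
    moreover have "(space ?P1 - E) \<times> B \<in> sets ?P2"
      using sets.compl_sets[OF E] by (intro pair_measureI) simp_all
    moreover have "emeasure (distr ?P2 borel Z) B = emeasure ?P2 (Z -` B \<inter> space ?P2)"
      by (rule emeasure_distr) simp_all
    ultimately have "emeasure (distr ?P2 borel Z) B
        = emeasure ?P2 ({p \<in> E. \<theta> (fst p) \<in> B} \<times> UNIV) + emeasure ?P2 ((space ?P1 - E) \<times> B)"
      by (subst plus_emeasure) auto
    also have "emeasure ?P2 ({p \<in> E. \<theta> (fst p) \<in> B} \<times> UNIV) = emeasure \<rho> B * emeasure K UNIV"
      using EB[of B] sets.top[of K] by (subst K.emeasure_pair_measure_Times) (simp_all add: E_eq)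
    also have "emeasure ?P2 ((space ?P1 - E) \<times> B) = emeasure \<kappa> UNIV * emeasure K B"
      using sets.compl_sets[OF E] by (subst K.emeasure_pair_measure_Times) (simp_all add: compl)
    also have "emeasure \<rho> B * emeasure K UNIV + emeasure \<kappa> UNIV * emeasure K B = emeasure \<nu>' B"
      using K.emeasure_space_1 by (simp add: K_eq split)
    finally show "emeasure (distr ?P2 borel Z) B = emeasure \<nu>' B" .
  qed simp
  let ?Q = "?P2 \<Otimes>\<^sub>M unif"
  interpret Q: pair_prob_space ?P2 unif ..
  define X where "X = (\<lambda>p :: (('a \<times> real) \<times> 'c) \<times> real. fst (fst (fst p)))"
  define Y where "Y = (\<lambda>(p, v). \<Psi> (Z p, v))"
  have X[measurable]: "X \<in> measurable ?Q \<alpha>" unfolding X_def by measurable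
  have Y[measurable]: "Y \<in> borel_measurable ?Q" unfolding Y_def case_prod_unfold by measurable
  have X_law: "distr ?Q \<alpha> X = \<alpha>"
  proof -
    have "distr ?Q \<alpha> X = distr (distr (distr ?Q ?P2 fst) ?P1 fst) \<alpha> fst"
      by (simp add: distr_distr o_def X_def)
    also have "\<dots> = \<alpha>"
      by (simp only: U.distr_pair_fst K.distr_pair_fst)
    finally show ?thesis .
  qed
  have ZY_law: "distr ?Q (borel \<Otimes>\<^sub>M borel) (\<lambda>p. (Z (fst p), Y p)) = distr \<beta> (borel \<Otimes>\<^sub>M borel) (\<lambda>\<omega>. (\<theta>' \<omega>, \<omega>))"
  proof -
    have "\<nu>' \<Otimes>\<^sub>M unif = distr ?P2 borel Z \<Otimes>\<^sub>M distr unif borel (\<lambda>u. u)"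
      unfolding Z_law by (subst distr_id2) auto
    also have "\<dots> = distr ?Q (borel \<Otimes>\<^sub>M borel) (\<lambda>(p, v). (Z p, v))"
      by (rule pair_measure_distr) (auto intro!: prob_space_imp_sigma_finite U.prob_space_distr)
    finally show ?thesis
      unfolding law[symmetric] by (simp add: distr_distr o_def Y_def case_prod_unfold)
  qed
  have Y_law: "distr ?Q borel Y = \<beta>"
  proof -
    have "distr ?Q borel Y = distr (distr ?Q (borel \<Otimes>\<^sub>M borel) (\<lambda>p. (Z (fst p), Y p))) borel snd"
      by (simp add: distr_distr o_def)
    also have "\<dots> = distr \<beta> borel (\<lambda>\<omega>. \<omega>)"
      unfolding ZY_law by (simp add: distr_distr o_def)
    finally show ?thesis by (simp add: distr_id2)
  qed
  \<comment> \<open>the outsourced point lies over the value it was drawn for, because its joint law with that value is carried by the graph of \<open>\<theta>'\<close>; distances express the graph as a measurable set\<close>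
  have ZY: "AE p in ?Q. \<theta>' (Y p) = Z (fst p)"
  proof -
    have "AE q in distr \<beta> (borel \<Otimes>\<^sub>M borel) (\<lambda>\<omega>. (\<theta>' \<omega>, \<omega>)). dist (\<theta>' (snd q)) (fst q) = 0"
      by (subst AE_distr_iff) auto
    then show ?thesis
      unfolding ZY_law[symmetric] by (subst (asm) AE_distr_iff) auto
  qed
  have "emeasure ?Q ((E \<times> UNIV) \<times> UNIV) = emeasure \<rho> UNIV"
  proof -
    have EK: "E \<times> UNIV \<in> sets ?P2"
      using E sets.top[of K] by (intro pair_measureI) simp_all
    have "emeasure ?Q ((E \<times> UNIV) \<times> UNIV) = emeasure ?P2 (E \<times> UNIV) * emeasure unif UNIV"
      using EK by (rule U.emeasure_pair_measure_Times) simp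
    also have "emeasure ?P2 (E \<times> UNIV) = emeasure ?P1 E * emeasure K UNIV"
      using E by (rule K.emeasure_pair_measure_Times) simp
    finally show ?thesis
      using E_eq[of UNIV] K.emeasure_space_1 U.emeasure_space_1 by simp
  qed
  moreover have "emeasure ?Q ((E \<times> UNIV) \<times> UNIV) \<le> emeasure ?Q {p \<in> space ?Q. dist (\<theta> (X p)) (\<theta>' (Y p)) = 0}"
  proof (rule emeasure_mono_AE)
    show "AE p in ?Q. p \<in> (E \<times> UNIV) \<times> UNIV \<longrightarrow> p \<in> {p \<in> space ?Q. dist (\<theta> (X p)) (\<theta>' (Y p)) = 0}"
      using ZY AE_space by eventually_elim (auto simp: X_def Z_def)
  qed measurable
  ultimately have "emeasure ?Q {p \<in> space ?Q. \<theta> (X p) = \<theta>' (Y p)} \<noteq> 0"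
    using \<rho>0 by auto
  with Q.P.prob_space_axioms X Y X_law Y_law show thesis by (rule that)
qed

section \<open>Laws of the random walk\<close>

definition psum :: "(nat \<Rightarrow> 'a::monoid_add) \<Rightarrow> nat \<Rightarrow> 'a" where
  "psum \<omega> n = sum_list (map \<omega> [0..<n])"

lemma psum_0 [simp]: "psum \<omega> 0 = 0"
  and psum_Suc [simp]: "psum \<omega> (Suc n) = psum \<omega> n + \<omega> n"
  by (simp_all add: psum_def)

lemma psum_case_nat: "psum (case_nat s \<omega>) (Suc n) = s + psum \<omega> n"
  by (induction n) (simp_all add: add.assoc)

lemma psum_comb_seq: "psum (comb_seq n \<omega> \<omega>') (n + k) = psum \<omega> n + psum \<omega>' k"
proof (induction k)
  case 0
  have "map (comb_seq n \<omega> \<omega>') [0..<n] = map \<omega> [0..<n]"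
    by (intro map_cong) (auto simp: comb_seq_def)
  then have "psum (comb_seq n \<omega> \<omega>') n = psum \<omega> n"
    by (simp only: psum_def)
  then show ?case by simp
next
  case (Suc k)
  then show ?case using comb_seq_add[of n \<omega> \<omega>' k] by (simp add: add.assoc add.commute[of n])
qed

lemma psum_measurable [measurable]:
  assumes "sets \<mu> = sets (borel :: 'a::{topological_group_add, polish_space} measure)"
  shows "(\<lambda>\<omega>. psum \<omega> n) \<in> borel_measurable (\<Pi>\<^sub>M i\<in>UNIV. \<mu>)"
proof (induction n)
  case (Suc n)
  note assms[measurable_cong] Suc[measurable]
  have [measurable]: "(\<lambda>\<omega>. \<omega> n) \<in> borel_measurable (\<Pi>\<^sub>M i\<in>UNIV. \<mu>)"
    using measurable_component_singleton[of n UNIV "\<lambda>_. \<mu>"] by (simp cong: measurable_cong_sets add: assms)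
  show ?case unfolding psum_Suc by measurable
qed simp

lemma translate_psum_measurable:
  assumes \<rho>[measurable_cong]: "sets \<rho> = sets (borel :: 'a::{topological_group_add, polish_space} measure)"
    and \<mu>: "sets \<mu> = sets (borel :: 'a measure)"
  shows "(\<lambda>(z, \<omega>) k. z + psum \<omega> k) \<in> measurable (\<rho> \<Otimes>\<^sub>M (\<Pi>\<^sub>M i\<in>UNIV. \<mu>)) (\<Pi>\<^sub>M n\<in>UNIV. borel)"
proof -
  note psum_measurable[OF \<mu>, measurable]
  show ?thesis
    unfolding case_prod_unfold by (rule measurable_PiM_single') auto
qed

locale random_walk = prob_space \<mu>
  for \<mu> :: "'a::{topological_group_add, polish_space} measure" +
  assumes sets_\<mu> [measurable_cong, simp]: "sets \<mu> = sets borel"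
begin

sublocale sequence_space \<mu>
  by unfold_locales

abbreviation paths :: "(nat \<Rightarrow> 'a) measure" where
  "paths \<equiv> \<Pi>\<^sub>M n\<in>UNIV. borel"

lemma psum_measurable' [measurable]: "(\<lambda>\<omega>. psum \<omega> n) \<in> borel_measurable S"
  by (rule psum_measurable) simp

lemma sets_conv_pow [measurable_cong, simp]: "sets (conv_pow \<mu> n) = sets borel"
  by (cases n) (simp_all add: conv_def)

lemma distr_psum: "distr S borel (\<lambda>\<omega>. psum \<omega> n) = conv_pow \<mu> n"
proof (induction n)
  case 0
  have "distr S borel (\<lambda>\<omega>. psum \<omega> 0) = return borel (0 :: 'a)"
    by (intro measure_eqI) (auto simp: emeasure_distr P.emeasure_space_1 split: split_indicator)
  then show ?case by simp
next
  case (Suc n)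
  have "distr S borel (\<lambda>\<omega>. psum \<omega> (Suc n))
      = distr (distr (\<mu> \<Otimes>\<^sub>M S) S (\<lambda>(s, \<omega>). case_nat s \<omega>)) borel (\<lambda>\<omega>. psum \<omega> (Suc n))"
    by (simp only: PiM_iter)
  also have "\<dots> = distr (\<mu> \<Otimes>\<^sub>M S) borel (\<lambda>(s, \<omega>). s + psum \<omega> n)"
    by (subst distr_distr) (simp_all add: o_def case_prod_unfold psum_case_nat del: psum_Suc)
  also have "\<dots> = distr (distr (\<mu> \<Otimes>\<^sub>M S) (\<mu> \<Otimes>\<^sub>M borel) (\<lambda>(s, \<omega>). (s, psum \<omega> n))) borel (\<lambda>(y, z). y + z)"
    by (subst distr_distr) (simp_all add: o_def case_prod_unfold)
  also have "distr (\<mu> \<Otimes>\<^sub>M S) (\<mu> \<Otimes>\<^sub>M borel) (\<lambda>(s, \<omega>). (s, psum \<omega> n))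
      = distr \<mu> \<mu> (\<lambda>s. s) \<Otimes>\<^sub>M distr S borel (\<lambda>\<omega>. psum \<omega> n)"
    by (intro pair_measure_distr[symmetric]) (auto intro!: prob_space_imp_sigma_finite P.prob_space_distr P.prob_space_axioms)
  finally show ?case
    by (simp add: Suc.IH conv_def)
qed

lemma prob_space_conv_pow: "prob_space (conv_pow \<mu> n)"
  unfolding distr_psum[symmetric] by (rule P.prob_space_distr) simp

lemma sets_theta [measurable_cong, simp]: "sets (theta x \<nu>) = sets borel"
  by (simp add: theta_def)

lemma RW_eq: "RW x \<mu> = distr S paths (\<lambda>\<omega> n. x + psum \<omega> n)"
  by (simp add: RW_def psum_def)

lemma walk_measurable [measurable]: "(\<lambda>\<omega> n. x + psum \<omega> n) \<in> measurable S paths"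
  by (rule measurable_PiM_single') auto

lemma prob_space_RW: "prob_space (RW x \<mu>)"
  unfolding RW_eq by (rule P.prob_space_distr) simp

lemma sets_RW [measurable_cong, simp]: "sets (RW x \<mu>) = sets paths"
  by (simp add: RW_eq)

lemma distr_RW_at: "distr (RW x \<mu>) borel (\<lambda>s. s n) = theta x (conv_pow \<mu> n)"
  unfolding RW_eq theta_def distr_psum[symmetric]
  by (subst (1 2) distr_distr) (simp_all add: o_def)

text \<open>
  The law of the walk with independent initial position distributed as \<open>\<rho>\<close>. The initial measure may
  have mass different from \<open>1\<close>, so that parts of initial laws can be transported.
\<close>

definition walk_from :: "'a measure \<Rightarrow> (nat \<Rightarrow> 'a) measure" where
  "walk_from \<rho> = distr (\<rho> \<Otimes>\<^sub>M S) paths (\<lambda>(z, \<omega>) k. z + psum \<omega> k)"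

lemma walk_from_mono:
  assumes \<rho>: "sets \<rho> = sets borel" and \<nu>: "sets \<nu> = sets borel"
    and le: "\<And>B. B \<in> sets borel \<Longrightarrow> emeasure \<rho> B \<le> emeasure \<nu> B"
    and A: "A \<in> sets paths"
  shows "emeasure (walk_from \<rho>) A \<le> emeasure (walk_from \<nu>) A"
proof -
  let ?w = "\<lambda>(z :: 'a, \<omega>) k. z + psum \<omega> k"
  have eq: "emeasure (walk_from \<sigma>) A = (\<integral>\<^sup>+z. emeasure S (Pair z -` (?w -` A \<inter> UNIV \<times> space S)) \<partial>\<sigma>)"
    if \<sigma>: "sets \<sigma> = sets borel" for \<sigma>
  proof -
    note w = translate_psum_measurable[OF \<sigma> sets_\<mu>]
    have sp: "space (\<sigma> \<Otimes>\<^sub>M S) = UNIV \<times> space S"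
      using sets_eq_imp_space_eq[OF \<sigma>] by (simp add: space_pair_measure)
    show ?thesis
      unfolding walk_from_def emeasure_distr[OF w A] sp
      by (rule P.emeasure_pair_measure_alt) (use measurable_sets[OF w A] sp in simp)
  qed
  have "\<rho> \<le> \<nu>"
    using \<rho> \<nu> le by (simp add: le_measure)
  then show ?thesis
    unfolding eq[OF \<rho>] eq[OF \<nu>] using \<rho> \<nu> by (intro nn_integral_mono_measure) simp_all
qed

lemma emeasure_walk_from_UNIV:
  assumes "sets \<rho> = sets borel"
  shows "emeasure (walk_from \<rho>) UNIV = emeasure \<rho> UNIV"
proof -
  have "emeasure (walk_from \<rho>) UNIV = emeasure (\<rho> \<Otimes>\<^sub>M S) (UNIV \<times> space S)"
    unfolding walk_from_def
    using sets_eq_imp_space_eq[OF assms] sets.top[of paths]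
    by (subst emeasure_distr[OF translate_psum_measurable[OF assms sets_\<mu>]])
      (simp_all add: space_pair_measure space_PiM)
  also have "\<dots> = emeasure \<rho> UNIV"
    using sets.top[of \<rho>] sets_eq_imp_space_eq[OF assms]
    by (simp add: P.emeasure_pair_measure_Times P.emeasure_space_1)
  finally show ?thesis .
qed

lemma shift_measurable: "(\<lambda>s k. s (n + k)) \<in> measurable paths paths"
  by (rule measurable_PiM_single') auto

text \<open>
  The Markov property at time \<open>n\<close>: splitting an i.i.d. sequence into its first \<open>n\<close> entries and the rest
  gives two independent sequences, the second one again i.i.d.
\<close>

lemma distr_RW_shift:
  "distr (RW x \<mu>) paths (\<lambda>s k. s (n + k)) = walk_from (theta x (conv_pow \<mu> n))"
proof -
  note shift_measurable[measurable]
  have [measurable]: "(\<lambda>\<omega> k. x + psum \<omega> (n + k)) \<in> measurable S paths"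
    by (rule measurable_PiM_single') auto
  have "distr (RW x \<mu>) paths (\<lambda>s k. s (n + k)) = distr S paths (\<lambda>\<omega> k. x + psum \<omega> (n + k))"
    unfolding RW_eq by (subst distr_distr) (simp_all add: o_def)
  also have "\<dots> = distr (distr (S \<Otimes>\<^sub>M S) S (\<lambda>(\<omega>, \<omega>'). comb_seq n \<omega> \<omega>')) paths (\<lambda>\<omega> k. x + psum \<omega> (n + k))"
    by (simp only: PiM_comb_seq)
  also have "\<dots> = distr (S \<Otimes>\<^sub>M S) paths (\<lambda>(\<omega>, \<omega>') k. x + psum \<omega> n + psum \<omega>' k)"
    by (subst distr_distr) (simp_all add: o_def case_prod_unfold psum_comb_seq add.assoc)
  also have "\<dots> = distr (distr (S \<Otimes>\<^sub>M S) (borel \<Otimes>\<^sub>M S) (\<lambda>(\<omega>, \<omega>'). (x + psum \<omega> n, \<omega>'))) paths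
      (\<lambda>(z, \<omega>) k. z + psum \<omega> k)"
    using translate_psum_measurable[of borel \<mu>]
    by (subst distr_distr) (simp_all add: o_def case_prod_unfold)
  also have "distr (S \<Otimes>\<^sub>M S) (borel \<Otimes>\<^sub>M S) (\<lambda>(\<omega>, \<omega>'). (x + psum \<omega> n, \<omega>'))
      = distr S borel (\<lambda>\<omega>. x + psum \<omega> n) \<Otimes>\<^sub>M distr S S (\<lambda>\<omega>. \<omega>)"
    by (intro pair_measure_distr[symmetric]) (auto intro!: prob_space_imp_sigma_finite P.prob_space_distr P.prob_space_axioms)
  also have "distr S borel (\<lambda>\<omega>. x + psum \<omega> n) = theta x (conv_pow \<mu> n)"
    unfolding theta_def distr_psum[symmetric] by (subst distr_distr) (simp_all add: o_def)
  finally show ?thesis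
    by (simp add: walk_from_def)
qed

end

section \<open>Overlap of the time marginals and exact couplings\<close>

context random_walk
begin

lemma theta_uminus_theta: "sets \<nu> = sets borel \<Longrightarrow> theta (- x) (theta x \<nu>) = \<nu>"
  unfolding theta_def
  by (subst distr_distr) (simp_all add: o_def add.assoc[symmetric] distr_id2 cong: measurable_cong_sets)

lemma emeasure_theta_mono:
  assumes "sets \<nu> = sets borel" "sets \<nu>' = sets borel" "B \<in> sets borel"
    and "\<And>B. B \<in> sets borel \<Longrightarrow> emeasure \<nu> B \<le> emeasure \<nu>' B"
  shows "emeasure (theta x \<nu>) B \<le> emeasure (theta x \<nu>') B"
proof -
  have "(\<lambda>y. x + y) -` B \<in> sets borel"
    using measurable_sets[of "\<lambda>y. x + y" borel borel B] assms(3) by simp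
  then show ?thesis
    using assms sets_eq_imp_space_eq[OF assms(1)] sets_eq_imp_space_eq[OF assms(2)]
    by (simp add: theta_def emeasure_distr cong: measurable_cong_sets)
qed

lemma emeasure_theta_UNIV: "sets \<nu> = sets borel \<Longrightarrow> emeasure (theta x \<nu>) UNIV = emeasure \<nu> UNIV"
  using sets_eq_imp_space_eq[of \<nu> borel] by (simp add: theta_def emeasure_distr cong: measurable_cong_sets)

lemma inf_neq_null_iff:
  fixes \<nu> \<nu>' :: "'a measure"
  assumes s: "sets \<nu> = sets borel" "sets \<nu>' = sets borel"
  shows "inf \<nu> \<nu>' \<noteq> null_measure borel \<longleftrightarrow>
    (\<exists>\<rho>. sets \<rho> = sets borel \<and> emeasure \<rho> UNIV \<noteq> 0 \<and>
      (\<forall>B\<in>sets borel. emeasure \<rho> B \<le> emeasure \<nu> B \<and> emeasure \<rho> B \<le> emeasure \<nu>' B))"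
    (is "?L \<longleftrightarrow> ?R")
proof
  assume L: ?L
  have "emeasure (inf \<nu> \<nu>') UNIV \<noteq> 0"
  proof
    assume 0: "emeasure (inf \<nu> \<nu>') UNIV = 0"
    have "inf \<nu> \<nu>' = null_measure borel"
    proof (rule measure_eqI)
      fix B show "emeasure (inf \<nu> \<nu>') B = emeasure (null_measure borel) B"
        using 0 emeasure_mono[of B UNIV "inf \<nu> \<nu>'"] inf_borel_measure(1)[OF s]
          sets.top[of "borel :: 'a measure"] by (simp add: le_zero_eq)
    qed (simp add: inf_borel_measure(1)[OF s])
    with L show False ..
  qed
  then show ?R
    using inf_borel_measure(1-3)[OF s] by (intro exI[of _ "inf \<nu> \<nu>'"]) auto
next
  assume ?R
  then obtain \<rho> where "sets \<rho> = sets borel" "emeasure \<rho> UNIV \<noteq> 0"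
    "\<forall>B\<in>sets borel. emeasure \<rho> B \<le> emeasure \<nu> B" "\<forall>B\<in>sets borel. emeasure \<rho> B \<le> emeasure \<nu>' B"
    by blast
  then have "emeasure (inf \<nu> \<nu>') UNIV \<noteq> 0"
    using inf_borel_measure(4)[OF s, of \<rho> UNIV] by auto
  then show ?L by auto
qed

text \<open>
  If \<open>\<rho>\<close> lies below \<open>m\<close> and \<open>theta y m\<close>, then \<open>theta (- y) \<rho>\<close> lies below \<open>theta (- y) m\<close> and \<open>m\<close>.
\<close>

lemma overlap_iff:
  "inf (conv_pow \<mu> n) (theta (- x) (conv_pow \<mu> n)) \<noteq> null_measure borel \<longleftrightarrow>
    inf (conv_pow \<mu> n) (theta x (conv_pow \<mu> n)) \<noteq> null_measure borel"
proof -
  have *: "inf (conv_pow \<mu> n) (theta (- y) (conv_pow \<mu> n)) \<noteq> null_measure borel"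
    if ov: "inf (conv_pow \<mu> n) (theta y (conv_pow \<mu> n)) \<noteq> null_measure borel" for y
  proof -
    let ?m = "conv_pow \<mu> n"
    obtain \<rho> where \<rho>: "sets \<rho> = sets borel" "emeasure \<rho> UNIV \<noteq> 0"
      and le: "\<And>B. B \<in> sets borel \<Longrightarrow> emeasure \<rho> B \<le> emeasure ?m B"
        "\<And>B. B \<in> sets borel \<Longrightarrow> emeasure \<rho> B \<le> emeasure (theta y ?m) B"
      using ov by (auto simp: inf_neq_null_iff)
    show ?thesis
      unfolding inf_neq_null_iff[OF sets_conv_pow sets_theta]
    proof (intro exI[of _ "theta (- y) \<rho>"] conjI ballI)
      fix B :: "'a set" assume B: "B \<in> sets borel"
      show "emeasure (theta (- y) \<rho>) B \<le> emeasure (theta (- y) ?m) B"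
        by (rule emeasure_theta_mono) (use \<rho> le B in auto)
      have "emeasure (theta (- y) \<rho>) B \<le> emeasure (theta (- y) (theta y ?m)) B"
        by (rule emeasure_theta_mono) (use \<rho> le B in auto)
      then show "emeasure (theta (- y) \<rho>) B \<le> emeasure ?m B"
        by (simp add: theta_uminus_theta)
    qed (use \<rho> in \<open>simp_all add: emeasure_theta_UNIV\<close>)
  qed
  from *[of x] *[of "- x"] show ?thesis by auto
qed

lemma distr_walk_at:
  assumes S: "X \<in> measurable P paths" "distr P paths X = RW x \<mu>"
  shows "distr P borel (\<lambda>\<omega>. X \<omega> n) = theta x (conv_pow \<mu> n)"
proof -
  have "distr P borel (\<lambda>\<omega>. X \<omega> n) = distr (distr P paths X) borel (\<lambda>s. s n)"
    using S(1) by (subst distr_distr) (simp_all add: o_def)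
  then show ?thesis by (simp add: S(2) distr_RW_at)
qed

lemma theta_0: "sets \<nu> = sets borel \<Longrightarrow> theta 0 \<nu> = \<nu>"
  by (simp add: theta_def distr_id2)

text \<open>
  On the event \<open>T \<le> n\<close> both walks have the same position at time \<open>n\<close>; the law of this position
  restricted to the event is bounded by the law of either walk at time \<open>n\<close>.
\<close>

lemma overlap_if_coupling:
  assumes "exact_coupling \<mu> x P X Xx T" and pos: "measure P {\<omega> \<in> space P. T \<omega> \<le> enat n} > 0"
  shows "inf (conv_pow \<mu> n) (theta x (conv_pow \<mu> n)) \<noteq> null_measure borel"
proof -
  have P: "prob_space P"
    and X: "X \<in> measurable P paths" "distr P paths X = RW 0 \<mu>"
    and Xx: "Xx \<in> measurable P paths" "distr P paths Xx = RW x \<mu>"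
    and T: "T \<in> measurable P (count_space UNIV)"
    and eq: "\<forall>\<omega>\<in>space P. \<forall>n. T \<omega> \<le> enat n \<longrightarrow> X \<omega> n = Xx \<omega> n"
    using assms(1) by (auto simp: exact_coupling_def)
  interpret W: prob_space P by fact
  note [measurable] = T X(1) Xx(1)
  define A where "A = {\<omega> \<in> space P. T \<omega> \<le> enat n}"
  have A[measurable]: "A \<in> sets P" unfolding A_def by measurable
  define \<rho> where "\<rho> = distr (density P (indicator A)) borel (\<lambda>\<omega>. X \<omega> n)"
  have \<rho>: "emeasure \<rho> B = emeasure P {\<omega> \<in> A. X \<omega> n \<in> B}" if [measurable]: "B \<in> sets borel" for B
  proof -
    have "emeasure \<rho> B = (\<integral>\<^sup>+\<omega>. indicator A \<omega> * indicator ((\<lambda>\<omega>. X \<omega> n) -` B \<inter> space P) \<omega> \<partial>P)"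
      unfolding \<rho>_def by (simp add: emeasure_distr emeasure_density)
    also have "\<dots> = (\<integral>\<^sup>+\<omega>. indicator ({\<omega> \<in> space P. X \<omega> n \<in> B} \<inter> A) \<omega> \<partial>P)"
      by (intro nn_integral_cong) (auto split: split_indicator)
    also have "\<dots> = emeasure P ({\<omega> \<in> space P. X \<omega> n \<in> B} \<inter> A)"
      by (rule nn_integral_indicator) simp
    also have "{\<omega> \<in> space P. X \<omega> n \<in> B} \<inter> A = {\<omega> \<in> A. X \<omega> n \<in> B}"
      by (auto simp: A_def)
    finally show ?thesis .
  qed
  have at: "emeasure P {\<omega> \<in> space P. Y \<omega> n \<in> B} = emeasure (theta y (conv_pow \<mu> n)) B"
    if "Y \<in> measurable P paths" "distr P paths Y = RW y \<mu>" "B \<in> sets borel" for Y y B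
    using that(1,3) unfolding distr_walk_at[OF that(1,2), symmetric]
    by (subst emeasure_distr) (auto intro!: arg_cong[where f="emeasure P"])
  show ?thesis
    unfolding inf_neq_null_iff[OF sets_conv_pow sets_theta]
  proof (intro exI[of _ \<rho>] conjI ballI)
    show "emeasure \<rho> UNIV \<noteq> 0"
      using pos \<rho>[of UNIV] by (simp add: W.emeasure_eq_measure A_def)
    fix B :: "'a set" assume B[measurable]: "B \<in> sets borel"
    have "emeasure P {\<omega> \<in> A. X \<omega> n \<in> B} \<le> emeasure P {\<omega> \<in> space P. X \<omega> n \<in> B}"
      by (rule emeasure_mono) (auto simp: A_def)
    then show "emeasure \<rho> B \<le> emeasure (conv_pow \<mu> n) B"
      by (simp add: \<rho> at[OF X] theta_0)
    have "emeasure P {\<omega> \<in> A. X \<omega> n \<in> B} \<le> emeasure P {\<omega> \<in> space P. Xx \<omega> n \<in> B}"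
      using eq by (intro emeasure_mono) (auto simp: A_def)
    then show "emeasure \<rho> B \<le> emeasure (theta x (conv_pow \<mu> n)) B"
      by (simp add: \<rho> at[OF Xx])
  qed (simp add: \<rho>_def)
qed

text \<open>
  The map in the abstract coupling is the shift by \<open>n\<close>: paths with equal shifts agree at all times
  from \<open>n\<close> on, whereas equal positions at time \<open>n\<close> alone would say nothing about later times.
\<close>

lemma coupling_if_overlap:
  assumes "inf (conv_pow \<mu> n) (theta x (conv_pow \<mu> n)) \<noteq> null_measure borel"
  obtains P :: "'a coupling_point measure" and X Xx T
  where "possible_exact_coupling \<mu> x P X Xx T" "measure P {\<omega> \<in> space P. T \<omega> = enat n} > 0"
proof -
  let ?m = "conv_pow \<mu> n"
  let ?shift = "\<lambda>(s :: nat \<Rightarrow> 'a) k. s (n + k)"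
  have paths: "sets paths = sets (borel :: (nat \<Rightarrow> 'a) measure)"
    by (rule sets_PiM_equal_borel)
  interpret m: prob_space ?m by (rule prob_space_conv_pow)
  obtain \<rho> where \<rho>: "sets \<rho> = sets borel" "emeasure \<rho> UNIV \<noteq> 0"
    and le: "\<And>B. B \<in> sets borel \<Longrightarrow> emeasure \<rho> B \<le> emeasure ?m B"
      "\<And>B. B \<in> sets borel \<Longrightarrow> emeasure \<rho> B \<le> emeasure (theta x ?m) B"
    using assms by (auto simp: inf_neq_null_iff)
  \<comment> \<open>halving ensures total mass less than \<open>1\<close>, also when the two laws at time \<open>n\<close> coincide\<close>
  define \<tau> where "\<tau> = scale_measure (1/2) (walk_from \<rho>)"
  have \<tau>: "sets \<tau> = sets borel"
    by (simp add: \<tau>_def walk_from_def paths)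
  have \<tau>_UNIV: "emeasure \<tau> UNIV = emeasure \<rho> UNIV / 2"
    by (simp add: \<tau>_def emeasure_walk_from_UNIV[OF \<rho>(1)] ennreal_divide_times mult.commute divide_ennreal_def)
  have \<rho>_le1: "emeasure \<rho> UNIV \<le> 1"
    using le(1)[of UNIV] m.emeasure_space_1 sets_eq_imp_space_eq[OF sets_conv_pow] by simp
  have \<tau>_le: "emeasure \<tau> B \<le> emeasure (walk_from \<nu>) B"
    if \<nu>: "sets \<nu> = sets borel" "\<And>B. B \<in> sets borel \<Longrightarrow> emeasure \<rho> B \<le> emeasure \<nu> B"
      and B: "B \<in> sets borel" for \<nu> B
  proof -
    have "emeasure \<tau> B \<le> 1 * emeasure (walk_from \<rho>) B"
      unfolding \<tau>_def emeasure_scale_measure by (intro mult_right_mono) (simp_all add: divide_le_posI_ennreal)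
    also have "\<dots> \<le> emeasure (walk_from \<nu>) B"
      using walk_from_mono[OF \<rho>(1) \<nu>] B paths by simp
    finally show ?thesis .
  qed
  have shift_law: "distr (RW y \<mu>) borel ?shift = walk_from (theta y ?m)" for y
    unfolding distr_RW_shift[symmetric] by (rule distr_cong) (simp_all add: paths)
  have shift[measurable]: "?shift \<in> measurable borel borel"
    using shift_measurable[of n] by (simp add: paths cong: measurable_cong_sets)
  obtain Q :: "((((nat \<Rightarrow> 'a) \<times> real) \<times> (nat \<Rightarrow> 'a)) \<times> real) measure" and X Y
    where Q: "prob_space Q" and X: "X \<in> measurable Q (RW 0 \<mu>)" "distr Q (RW 0 \<mu>) X = RW 0 \<mu>"
      and Y: "Y \<in> borel_measurable Q" "distr Q borel Y = RW x \<mu>"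
      and meet: "emeasure Q {\<omega> \<in> space Q. ?shift (X \<omega>) = ?shift (Y \<omega>)} \<noteq> 0"
  proof (rule acceptance_coupling[of "RW 0 \<mu>" "RW x \<mu>" ?shift ?shift \<tau>])
    show "emeasure \<tau> UNIV < 1"
    proof -
      have "emeasure \<rho> UNIV / 2 \<le> 1 / 2"
        using \<rho>_le1 by (rule divide_right_mono_ennreal)
      also have "(1 / 2 :: ennreal) < 1" by (simp add: divide_less_ennreal)
      finally show ?thesis by (simp add: \<tau>_UNIV)
    qed
    show "emeasure \<tau> UNIV \<noteq> 0"
      using \<rho>(2) by (simp add: \<tau>_UNIV ennreal_divide_eq_0_iff)
    fix B :: "(nat \<Rightarrow> 'a) set" assume B: "B \<in> sets borel"
    show "emeasure \<tau> B \<le> emeasure (distr (RW 0 \<mu>) borel ?shift) B"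
      unfolding shift_law by (rule \<tau>_le) (use le B in \<open>simp_all add: theta_0\<close>)
    show "emeasure \<tau> B \<le> emeasure (distr (RW x \<mu>) borel ?shift) B"
      unfolding shift_law by (rule \<tau>_le) (use le B in simp_all)
  qed (use \<tau> shift in \<open>simp_all add: prob_space_RW paths cong: measurable_cong_sets\<close>)
  interpret Q: prob_space Q by fact
  have X': "X \<in> measurable Q paths" "X \<in> borel_measurable Q" and Y': "Y \<in> measurable Q paths"
    using X(1) Y(1) by (simp_all add: paths cong: measurable_cong_sets)
  have X_law: "distr Q paths X = RW 0 \<mu>"
  proof -
    have "distr Q paths X = distr Q (RW 0 \<mu>) X"
      by (rule distr_cong) simp_all
    then show ?thesis using X(2) by (rule trans)
  qed
  have Y_law: "distr Q paths Y = RW x \<mu>"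
  proof -
    have "distr Q paths Y = distr Q borel Y"
      by (rule distr_cong) (simp_all add: paths)
    then show ?thesis using Y(2) by (rule trans)
  qed
  note [measurable] = X'(2) Y(1)
  define A where "A = {\<omega> \<in> space Q. dist (?shift (X \<omega>)) (?shift (Y \<omega>)) = 0}"
  have A[measurable]: "A \<in> sets Q"
    unfolding A_def by measurable
  have A_eq: "A = {\<omega> \<in> space Q. ?shift (X \<omega>) = ?shift (Y \<omega>)}"
    by (simp add: A_def)
  have A_pos: "measure Q A > 0"
    using meet unfolding A_eq[symmetric] by (simp add: Q.emeasure_eq_measure zero_less_measure_iff)
  define T where "T \<omega> = (if \<omega> \<in> A then enat n else \<infinity>)" for \<omega>
  have "exact_coupling \<mu> x Q X Y T"
    unfolding exact_coupling_def
  proof (intro conjI ballI allI impI)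
    show "T \<in> measurable Q (count_space UNIV)"
      unfolding T_def by measurable
    fix \<omega> k assume "\<omega> \<in> space Q" "T \<omega> \<le> enat k"
    then have "\<omega> \<in> A" "n \<le> k"
      by (auto simp: T_def split: if_split_asm)
    then show "X \<omega> k = Y \<omega> k"
      using fun_cong[of "?shift (X \<omega>)" "?shift (Y \<omega>)" "k - n"] by (simp add: A_eq)
  qed (fact Q X' X_law Y' Y_law)+
  moreover have "{\<omega> \<in> space Q. T \<omega> < \<infinity>} = A" and T_n: "{\<omega> \<in> space Q. T \<omega> \<in> {enat n}} = A"
    using sets.sets_into_space[OF A] by (auto simp: T_def split: if_split_asm)
  ultimately have "possible_exact_coupling \<mu> x Q X Y T"
    using A_pos by (simp add: possible_exact_coupling_def)
  then show thesis
  proof (rule possible_exact_coupling_canonical)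
    fix R :: "'a coupling_point measure" and Z Zx U
    assume R: "possible_exact_coupling \<mu> x R Z Zx U"
      and law: "\<And>A. measure R {\<omega> \<in> space R. U \<omega> \<in> A} = measure Q {\<omega> \<in> space Q. T \<omega> \<in> A}"
    have "measure R {\<omega> \<in> space R. U \<omega> = enat n} > 0"
      using law[of "{enat n}"] A_pos unfolding T_n by simp
    with R show thesis by (rule that)
  qed
qed

end

theorem theorem6p1:
  fixes \<mu> :: "'a::{topological_group_add, polish_space} measure"
  assumes "prob_space \<mu>" and "sets \<mu> = sets borel"
  shows "(\<forall>x. \<forall>n\<ge>1.
      (\<exists>(P :: 'a coupling_point measure) S Sx T. possible_exact_coupling \<mu> x P S Sx T \<and>
          measure P {\<omega> \<in> space P. T \<omega> = enat n} > 0)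
      \<longleftrightarrow> inf (conv_pow \<mu> n) (theta (- x) (conv_pow \<mu> n)) \<noteq> null_measure borel)
    \<and> possible_exact_coupling_set \<mu> =
        {x. \<exists>n\<ge>1. inf (conv_pow \<mu> n) (theta (- x) (conv_pow \<mu> n)) \<noteq> null_measure borel}"
proof -
  interpret random_walk \<mu>
    using assms by (simp add: random_walk_def random_walk_axioms_def)
  let ?O = "\<lambda>x n. inf (conv_pow \<mu> n) (theta (- x) (conv_pow \<mu> n)) \<noteq> null_measure borel"
  have overlap: "?O x n"
    if "exact_coupling \<mu> x P X Xx T" "measure P A > 0" "A \<subseteq> {\<omega> \<in> space P. T \<omega> \<le> enat n}"
    for x n A and P :: "'a coupling_point measure" and X Xx T
  proof -
    have P: "prob_space P" and [measurable]: "T \<in> measurable P (count_space UNIV)"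
      using that(1) by (auto simp: exact_coupling_def)
    interpret W: prob_space P by fact
    have "measure P A \<le> measure P {\<omega> \<in> space P. T \<omega> \<le> enat n}"
      by (rule W.finite_measure_mono[OF that(3)]) measurable
    then show ?thesis
      using overlap_if_coupling[OF that(1), of n] that(2) by (simp add: overlap_iff)
  qed
  have iff: "(\<exists>(P :: 'a coupling_point measure) S Sx T. possible_exact_coupling \<mu> x P S Sx T \<and>
          measure P {\<omega> \<in> space P. T \<omega> = enat n} > 0) \<longleftrightarrow> ?O x n" for x n
  proof
    assume "?O x n"
    then have "inf (conv_pow \<mu> n) (theta x (conv_pow \<mu> n)) \<noteq> null_measure borel"
      by (simp only: overlap_iff not_False_eq_True)
    then obtain P :: "'a coupling_point measure" and X Xx T
      where "possible_exact_coupling \<mu> x P X Xx T" "measure P {\<omega> \<in> space P. T \<omega> = enat n} > 0"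
      by (rule coupling_if_overlap)
    then show "\<exists>(P :: 'a coupling_point measure) S Sx T. possible_exact_coupling \<mu> x P S Sx T \<and>
          measure P {\<omega> \<in> space P. T \<omega> = enat n} > 0"
      by blast
  next
    assume "\<exists>(P :: 'a coupling_point measure) S Sx T. possible_exact_coupling \<mu> x P S Sx T \<and>
          measure P {\<omega> \<in> space P. T \<omega> = enat n} > 0"
    then obtain P :: "'a coupling_point measure" and X Xx T
      where "exact_coupling \<mu> x P X Xx T" "measure P {\<omega> \<in> space P. T \<omega> = enat n} > 0"
      by (auto simp: possible_exact_coupling_def)
    then show "?O x n" by (rule overlap) auto
  qed
  have sub: "\<exists>n\<ge>1. ?O x n" if x: "x \<in> possible_exact_coupling_set \<mu>" for x
  proof -
    obtain P :: "'a coupling_point measure" and X Xx T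
      where ec: "exact_coupling \<mu> x P X Xx T" and pos: "measure P {\<omega> \<in> space P. T \<omega> < \<infinity>} > 0"
      using x by (auto simp: possible_exact_coupling_set_def possible_exact_coupling_def)
    then have P: "prob_space P" and [measurable]: "T \<in> measurable P (count_space UNIV)"
      by (auto simp: exact_coupling_def)
    interpret W: prob_space P by fact
    have "\<exists>n. measure P {\<omega> \<in> space P. T \<omega> = enat n} > 0"
    proof (rule ccontr)
      assume "\<nexists>n. measure P {\<omega> \<in> space P. T \<omega> = enat n} > 0"
      then have "emeasure P {\<omega> \<in> space P. T \<omega> = enat n} = 0" for n
        by (simp add: W.emeasure_eq_measure not_less measure_le_0_iff)
      then have "emeasure P (\<Union>n. {\<omega> \<in> space P. T \<omega> = enat n}) = 0"
        by (intro emeasure_UN_eq_0) auto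
      also have "(\<Union>n. {\<omega> \<in> space P. T \<omega> = enat n}) = {\<omega> \<in> space P. T \<omega> < \<infinity>}"
        by (auto elim: less_infinityE)
      finally show False using pos by (simp add: measure_def)
    qed
    then obtain n where n: "measure P {\<omega> \<in> space P. T \<omega> = enat n} > 0" ..
    \<comment> \<open>a coupling at time \<open>0\<close> is also one by time \<open>1\<close>\<close>
    have "?O x (max 1 n)"
      using ec n by (rule overlap) auto
    then show ?thesis by (intro exI[of _ "max 1 n"]) simp
  qed
  have "possible_exact_coupling_set \<mu> = {x. \<exists>n\<ge>1. ?O x n}"
  proof (intro set_eqI iffI)
    fix x assume "x \<in> {x. \<exists>n\<ge>1. ?O x n}"
    then obtain n where "?O x n" by blast
    then show "x \<in> possible_exact_coupling_set \<mu>"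
      using iff[of x n] unfolding possible_exact_coupling_set_def by blast
  next
    fix x assume "x \<in> possible_exact_coupling_set \<mu>"
    then show "x \<in> {x. \<exists>n\<ge>1. ?O x n}"
      using sub by simp
  qed
  with iff show ?thesis
    by (intro conjI allI impI)
qed

end
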